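(* $\mathcal{H}\mathbf{K}\mathsf{biG}$ is weakly complete: for any $\phi\in\mathcal{L}_{\triangle,\Box,\lozenge}$, it holds that $\models_{\mathbf{K}\mathsf{biG}}\phi$ iff $\mathcal{H}\mathbf{K}\mathsf{biG}\vdash\phi$.
   Context: The language $\mathcal{L}_{\triangle,\Box,\lozenge}$ is generated from a countable set of variables by ${\sim},\triangle,\wedge,\vee,\rightarrow,\Box,\lozenge$; $\mathbf{1}\coloneqq p\rightarrow p$, $\mathbf{0}\coloneqq{\sim}\mathbf{1}$. On $[0,1]$: $a\wedge b=\min(a,b)$, $a\vee b=\max(a,b)$, $a\rightarrow b=1$ if $a\leq b$ and $b$ otherwise, ${\sim}a=1$ if $a=0$ and $0$ otherwise, $\triangle a=1$ if $a=1$ and $0$ otherwise. A crisp $\mathbf{K}\mathsf{biG}$ model is $\langle W,R,v\rangle$ with $W\neq\varnothing$, $R\subseteq W\times W$, $v$ assigning to each variable and state a value in $[0,1]$, extended statewise for propositional connectives and by $v(\Box\phi,w)=\inf\{v(\phi,w'):wRw'\}$, $v(\lozenge\phi,w)=\sup\{v(\phi,w'):wRw'\}$ ($\inf\varnothing=1$, $\sup\varnothing=0$). $\models_{\mathbf{K}\mathsf{biG}}\phi$ means $v(\phi,w)=1$ in every state of every crisp model. The calculus $\mathcal{H}\mathbf{K}\mathsf{biG}$ consists of: all substitution instances of theorems and rules of the Hilbert calculus $\mathcal{H}\mathsf{biG}$ for bi-Gödel logic (axioms of Gödel logic — $(\phi\rightarrow\chi)\rightarrow((\chi\rightarrow\psi)\rightarrow(\phi\rightarrow\psi))$,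 $\phi\rightarrow(\phi\vee\chi)$, $\chi\rightarrow(\phi\vee\chi)$, $(\phi\rightarrow\psi)\rightarrow((\chi\rightarrow\psi)\rightarrow((\phi\vee\chi)\rightarrow\psi))$, $(\phi\wedge\chi)\rightarrow\phi$, $(\phi\wedge\chi)\rightarrow\chi$, $(\phi\rightarrow\chi)\rightarrow((\phi\rightarrow\psi)\rightarrow(\phi\rightarrow(\chi\wedge\psi)))$, $(\phi\rightarrow(\chi\rightarrow\psi))\leftrightarrow((\phi\wedge\chi)\rightarrow\psi)$ as two implications, $(\phi\rightarrow\chi)\rightarrow({\sim}\chi\rightarrow{\sim}\phi)$, $(\phi\rightarrow\chi)\vee(\chi\rightarrow\phi)$ — plus $\triangle\phi\vee{\sim}\triangle\phi$, $\triangle(\phi\rightarrow\chi)\rightarrow(\triangle\phi\rightarrow\triangle\chi)$, $\triangle(\phi\vee\chi)\rightarrow(\triangle\phi\vee\triangle\chi)$, $\triangle\phi\rightarrow\phi$, $\triangle\phi\rightarrow\triangle\triangle\phi$, modus ponens and $\triangle$-necessitation $\vdash\phi/\vdash\triangle\phi$); the axioms ${\sim}\lozenge\mathbf{0}$; $\Box(\phi\rightarrow\chi)\rightarrow(\Box\phi\rightarrow\Box\chi)$; $\lozenge(\phi\vee\chi)\rightarrow(\lozenge\phi\vee\lozenge\chi)$; $\lozenge(\phi\rightarrow\chi)\rightarrow(\Box\phi\rightarrow\lozenge\chi)$; $(\lozenge\phi\rightarrow\Box\chi)\rightarrow\Box(\phi\rightarrow\chi)$; ${\sim}\triangle(\lozenge\phi\rightarrow\lozenge\chi)\rightarrow\lozenge{\sim}\triangle(\phi\rightarrow\chi)$;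 $\Box(\phi\vee\chi)\rightarrow(\Box\phi\vee\lozenge\chi)$; $\triangle\Box\phi\rightarrow\Box\triangle\phi$; and the rules $\vdash\phi/\vdash\Box\phi$ and $\vdash\phi\rightarrow\chi/\vdash\lozenge\phi\rightarrow\lozenge\chi$.
   Formalization: The axiom scheme 0→φ (ex falso) is added to the listed axioms of HbiG, since without it the valid formula 0→q is not derivable (read ~ as the constant 1 and □, ◇ as the identity). *)

theory Defs
  imports Complex_Main
begin

datatype fm =
    Var nat
  | Neg fm        ("\<^bold>\<sim> _" [75] 75)
  | Delta fm      ("\<triangle> _" [75] 75)
  | Conj fm fm    (infixr "\<^bold>\<and>" 65)
  | Disj fm fm    (infixr "\<^bold>\<or>" 60)
  | Imp fm fm     (infixr "\<^bold>\<rightarrow>" 55)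
  | Box fm        ("\<box> _" [75] 75)
  | Dia fm        ("\<diamond> _" [75] 75)

definition Top :: fm ("\<^bold>1") where
  "\<^bold>1 = (Var 0 \<^bold>\<rightarrow> Var 0)"

definition Bot :: fm ("\<^bold>0") where
  "\<^bold>0 = \<^bold>\<sim> \<^bold>1"

definition g_imp :: "real \<Rightarrow> real \<Rightarrow> real" where
  "g_imp a b = (if a \<le> b then 1 else b)"

definition g_neg :: "real \<Rightarrow> real" where
  "g_neg a = (if a = 0 then 1 else 0)"

definition g_delta :: "real \<Rightarrow> real" where
  "g_delta a = (if a = 1 then 1 else 0)"

text \<open>Infima and suprema in the lattice \<open>[0,1]\<close>: on \<open>real\<close>, the values of \<open>Inf {}\<close> and
  \<open>Sup {}\<close> are not the required ones.\<close>

definition inf01 :: "real set \<Rightarrow> real" where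
  "inf01 A = (if A = {} then 1 else Inf A)"

definition sup01 :: "real set \<Rightarrow> real" where
  "sup01 A = (if A = {} then 0 else Sup A)"

definition crisp_model :: "'w set \<Rightarrow> ('w \<times> 'w) set \<Rightarrow> (nat \<Rightarrow> 'w \<Rightarrow> real) \<Rightarrow> bool" where
  "crisp_model W R v \<longleftrightarrow>
     W \<noteq> {} \<and> R \<subseteq> W \<times> W \<and> (\<forall>p. \<forall>w\<in>W. 0 \<le> v p w \<and> v p w \<le> 1)"

primrec eval :: "('w \<times> 'w) set \<Rightarrow> (nat \<Rightarrow> 'w \<Rightarrow> real) \<Rightarrow> fm \<Rightarrow> 'w \<Rightarrow> real" where
  "eval R v (Var p) w = v p w"
| "eval R v (\<^bold>\<sim> \<phi>) w = g_neg (eval R v \<phi> w)"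
| "eval R v (\<triangle> \<phi>) w = g_delta (eval R v \<phi> w)"
| "eval R v (\<phi> \<^bold>\<and> \<chi>) w = min (eval R v \<phi> w) (eval R v \<chi> w)"
| "eval R v (\<phi> \<^bold>\<or> \<chi>) w = max (eval R v \<phi> w) (eval R v \<chi> w)"
| "eval R v (\<phi> \<^bold>\<rightarrow> \<chi>) w = g_imp (eval R v \<phi> w) (eval R v \<chi> w)"
| "eval R v (\<box> \<phi>) w = inf01 {eval R v \<phi> w' | w'. (w, w') \<in> R}"
| "eval R v (\<diamond> \<phi>) w = sup01 {eval R v \<phi> w' | w'. (w, w') \<in> R}"

text \<open>Validity in all crisp models whose states are drawn from the type \<open>'w\<close>; states form an
  arbitrary nonempty subset of \<open>'w\<close>. HOL cannot quantify over all types inside a formula, so the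
  type is a parameter. Since a model lives on a subset of the type, every infinite type of states
  gives the same valid formulas as the class of all models: smaller models embed into it, and
  a refuting model of any size has a countable refuting submodel (for each of its states and each
  subformula, countably many successors approximate the infimum and the supremum).\<close>

definition KbiG_valid :: "'w itself \<Rightarrow> fm \<Rightarrow> bool" where
  "KbiG_valid T \<phi> \<longleftrightarrow>
     (\<forall>(W :: 'w set) R v. crisp_model W R v \<longrightarrow> (\<forall>w\<in>W. eval R v \<phi> w = 1))"

text \<open>The schemas range over the full modal language, so this set contains all substitution
  instances of the axioms of bi-Goedel logic.

  The schema \<open>ex_falso\<close> is not implied by the rest: since \<open>\<^bold>\<sim>\<close> is primitive and \<open>\<^bold>0\<close> is \<open>\<^bold>\<sim> \<^bold>1\<close>,
  all other schemas, including the modal ones, are also valid when \<open>\<^bold>\<sim>\<close> is read as the constant 1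
  and both modalities as the identity, which refutes \<open>\<^bold>0 \<^bold>\<rightarrow> \<phi>\<close>. Some presentations of the calculus
  omit it from the list, but without it the calculus is not complete for bi-Goedel logic.\<close>

inductive biG_axiom :: "fm \<Rightarrow> bool" where
  trans: "biG_axiom ((\<phi> \<^bold>\<rightarrow> \<chi>) \<^bold>\<rightarrow> ((\<chi> \<^bold>\<rightarrow> \<psi>) \<^bold>\<rightarrow> (\<phi> \<^bold>\<rightarrow> \<psi>)))"
| disjI1: "biG_axiom (\<phi> \<^bold>\<rightarrow> (\<phi> \<^bold>\<or> \<chi>))"
| disjI2: "biG_axiom (\<chi> \<^bold>\<rightarrow> (\<phi> \<^bold>\<or> \<chi>))"
| disjE: "biG_axiom ((\<phi> \<^bold>\<rightarrow> \<psi>) \<^bold>\<rightarrow> ((\<chi> \<^bold>\<rightarrow> \<psi>) \<^bold>\<rightarrow> ((\<phi> \<^bold>\<or> \<chi>) \<^bold>\<rightarrow> \<psi>)))"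
| conjE1: "biG_axiom ((\<phi> \<^bold>\<and> \<chi>) \<^bold>\<rightarrow> \<phi>)"
| conjE2: "biG_axiom ((\<phi> \<^bold>\<and> \<chi>) \<^bold>\<rightarrow> \<chi>)"
| conjI: "biG_axiom ((\<phi> \<^bold>\<rightarrow> \<chi>) \<^bold>\<rightarrow> ((\<phi> \<^bold>\<rightarrow> \<psi>) \<^bold>\<rightarrow> (\<phi> \<^bold>\<rightarrow> (\<chi> \<^bold>\<and> \<psi>))))"
| uncurry: "biG_axiom ((\<phi> \<^bold>\<rightarrow> (\<chi> \<^bold>\<rightarrow> \<psi>)) \<^bold>\<rightarrow> ((\<phi> \<^bold>\<and> \<chi>) \<^bold>\<rightarrow> \<psi>))"
| curry: "biG_axiom (((\<phi> \<^bold>\<and> \<chi>) \<^bold>\<rightarrow> \<psi>) \<^bold>\<rightarrow> (\<phi> \<^bold>\<rightarrow> (\<chi> \<^bold>\<rightarrow> \<psi>)))"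
| contrapos: "biG_axiom ((\<phi> \<^bold>\<rightarrow> \<chi>) \<^bold>\<rightarrow> (\<^bold>\<sim> \<chi> \<^bold>\<rightarrow> \<^bold>\<sim> \<phi>))"
| ex_falso: "biG_axiom (\<^bold>0 \<^bold>\<rightarrow> \<phi>)"
| prelin: "biG_axiom ((\<phi> \<^bold>\<rightarrow> \<chi>) \<^bold>\<or> (\<chi> \<^bold>\<rightarrow> \<phi>))"
| delta_em: "biG_axiom (\<triangle> \<phi> \<^bold>\<or> \<^bold>\<sim> \<triangle> \<phi>)"
| delta_K: "biG_axiom (\<triangle> (\<phi> \<^bold>\<rightarrow> \<chi>) \<^bold>\<rightarrow> (\<triangle> \<phi> \<^bold>\<rightarrow> \<triangle> \<chi>))"
| delta_disj: "biG_axiom (\<triangle> (\<phi> \<^bold>\<or> \<chi>) \<^bold>\<rightarrow> (\<triangle> \<phi> \<^bold>\<or> \<triangle> \<chi>))"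
| delta_T: "biG_axiom (\<triangle> \<phi> \<^bold>\<rightarrow> \<phi>)"
| delta_4: "biG_axiom (\<triangle> \<phi> \<^bold>\<rightarrow> \<triangle> \<triangle> \<phi>)"

inductive modal_axiom :: "fm \<Rightarrow> bool" where
  dia_bot: "modal_axiom (\<^bold>\<sim> \<diamond> \<^bold>0)"
| box_K: "modal_axiom (\<box> (\<phi> \<^bold>\<rightarrow> \<chi>) \<^bold>\<rightarrow> (\<box> \<phi> \<^bold>\<rightarrow> \<box> \<chi>))"
| dia_disj: "modal_axiom (\<diamond> (\<phi> \<^bold>\<or> \<chi>) \<^bold>\<rightarrow> (\<diamond> \<phi> \<^bold>\<or> \<diamond> \<chi>))"
| dia_imp: "modal_axiom (\<diamond> (\<phi> \<^bold>\<rightarrow> \<chi>) \<^bold>\<rightarrow> (\<box> \<phi> \<^bold>\<rightarrow> \<diamond> \<chi>))"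
| dia_box: "modal_axiom ((\<diamond> \<phi> \<^bold>\<rightarrow> \<box> \<chi>) \<^bold>\<rightarrow> \<box> (\<phi> \<^bold>\<rightarrow> \<chi>))"
| dia_strict: "modal_axiom (\<^bold>\<sim> \<triangle> (\<diamond> \<phi> \<^bold>\<rightarrow> \<diamond> \<chi>) \<^bold>\<rightarrow> \<diamond> \<^bold>\<sim> \<triangle> (\<phi> \<^bold>\<rightarrow> \<chi>))"
| crisp: "modal_axiom (\<box> (\<phi> \<^bold>\<or> \<chi>) \<^bold>\<rightarrow> (\<box> \<phi> \<^bold>\<or> \<diamond> \<chi>))"
| delta_box: "modal_axiom (\<triangle> \<box> \<phi> \<^bold>\<rightarrow> \<box> \<triangle> \<phi>)"

inductive HKbiG :: "fm \<Rightarrow> bool" ("\<turnstile> _" [50] 50) where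
  biG: "biG_axiom \<phi> \<Longrightarrow> \<turnstile> \<phi>"
| modal: "modal_axiom \<phi> \<Longrightarrow> \<turnstile> \<phi>"
| mp: "\<turnstile> \<phi> \<Longrightarrow> \<turnstile> \<phi> \<^bold>\<rightarrow> \<chi> \<Longrightarrow> \<turnstile> \<chi>"
| delta_nec: "\<turnstile> \<phi> \<Longrightarrow> \<turnstile> \<triangle> \<phi>"
| box_nec: "\<turnstile> \<phi> \<Longrightarrow> \<turnstile> \<box> \<phi>"
| dia_mono: "\<turnstile> \<phi> \<^bold>\<rightarrow> \<chi> \<Longrightarrow> \<turnstile> \<diamond> \<phi> \<^bold>\<rightarrow> \<diamond> \<chi>"

end

theory Submission
  imports Defs "HOL-Library.Countable_Set"
begin

text \<open>Completeness goes through a canonical model whose states pair a prime \<open>\<triangle>\<close>-closed theory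
  \<open>T\<close> with a \<open>[0,1]\<close>-valuation \<open>e\<close> of a finite set \<open>F\<close> of formulas that represents the order
  \<open>a \<^bold>\<rightarrow> b \<in> T\<close>; a state \<open>e'\<close> is accessible from \<open>e\<close> if \<open>e (\<box> a) \<le> e' a \<le> e (\<diamond> a)\<close> whenever these
  are in \<open>F\<close>. To approximate \<open>e (\<box> a)\<close> from above, extend \<open>{b. \<box> b \<in> T}\<close> to a prime theory that
  contains no \<open>b\<close> with \<open>\<diamond> b \<notin> T\<close> and no \<open>b \<^bold>\<rightarrow> a\<close> with \<open>\<box> b \<^bold>\<rightarrow> \<box> a \<notin> T\<close>; the forbidden formulas are
  directed under disjunction and the axiom \<open>crisp\<close> keeps them apart. The order of the new theory
  is then compatible with the bounds that \<open>e\<close> prescribes, and because \<open>F\<close> is finite it can be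
  realised by reals within these bounds. For \<open>\<diamond> a\<close>, forbid the \<open>a \<^bold>\<rightarrow> b\<close> with
  \<open>\<diamond> a \<^bold>\<rightarrow> \<diamond> b \<notin> T\<close> instead, using \<open>dia_strict\<close>. Closing one refuting state under countably many
  such witnesses yields a countable model, which embeds into any infinite type.\<close>

section \<open>Soundness\<close>

lemma inf01_lower: "x \<in> A \<Longrightarrow> A \<subseteq> {0..1} \<Longrightarrow> inf01 A \<le> x"
  unfolding inf01_def by (auto intro!: cInf_lower bdd_belowI[of _ 0])

lemma inf01_greatest: "(\<And>x. x \<in> A \<Longrightarrow> c \<le> x) \<Longrightarrow> c \<le> 1 \<Longrightarrow> c \<le> inf01 A"
  unfolding inf01_def by (auto intro!: cInf_greatest)

lemma sup01_upper: "x \<in> A \<Longrightarrow> A \<subseteq> {0..1} \<Longrightarrow> x \<le> sup01 A"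
  unfolding sup01_def by (auto intro!: cSup_upper bdd_aboveI[of _ 1])

lemma sup01_least: "(\<And>x. x \<in> A \<Longrightarrow> x \<le> c) \<Longrightarrow> 0 \<le> c \<Longrightarrow> sup01 A \<le> c"
  unfolding sup01_def by (auto intro!: cSup_least)

lemma inf01_bounds: "A \<subseteq> {0..1} \<Longrightarrow> 0 \<le> inf01 A \<and> inf01 A \<le> 1"
proof (cases "A = {}")
  case False
  assume A: "A \<subseteq> {0..1}"
  obtain x where "x \<in> A" using False by auto
  then show ?thesis using inf01_lower[of x A] A by (auto intro!: inf01_greatest)
qed (simp add: inf01_def)

lemma sup01_bounds: "A \<subseteq> {0..1} \<Longrightarrow> 0 \<le> sup01 A \<and> sup01 A \<le> 1"
proof (cases "A = {}")
  case False
  assume A: "A \<subseteq> {0..1}"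
  obtain x where "x \<in> A" using False by auto
  then show ?thesis using sup01_upper[of x A] A by (auto intro!: sup01_least)
qed (simp add: sup01_def)

lemma eval_bounds:
  assumes "crisp_model W R v" and "w \<in> W"
  shows "0 \<le> eval R v \<phi> w \<and> eval R v \<phi> w \<le> 1"
  using assms(2)
proof (induction \<phi> arbitrary: w)
  case (Box \<phi>)
  have "{eval R v \<phi> w' | w'. (w, w') \<in> R} \<subseteq> {0..1}"
    using Box.IH assms(1) by (fastforce simp: crisp_model_def)
  from inf01_bounds[OF this] show ?case by simp
next
  case (Dia \<phi>)
  have "{eval R v \<phi> w' | w'. (w, w') \<in> R} \<subseteq> {0..1}"
    using Dia.IH assms(1) by (fastforce simp: crisp_model_def)
  from sup01_bounds[OF this] show ?case by simp
qed (use assms(1) in \<open>auto simp: crisp_model_def g_neg_def g_delta_def g_imp_def min_def max_def\<close>)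

lemma biG_axiom_sound:
  assumes "biG_axiom \<phi>" and "crisp_model W R v" and "w \<in> W"
  shows "eval R v \<phi> w = 1"
proof -
  have b: "0 \<le> eval R v \<psi> w" "eval R v \<psi> w \<le> 1"
    and b': "eval R v \<psi> w \<le> 0 \<longleftrightarrow> eval R v \<psi> w = 0" "1 \<le> eval R v \<psi> w \<longleftrightarrow> eval R v \<psi> w = 1" for \<psi>
    using eval_bounds[OF assms(2,3), of \<psi>] by auto
  show ?thesis
    using assms(1)
    by cases (auto simp: Bot_def Top_def g_imp_def g_neg_def g_delta_def min_def max_def b b')
qed

context
  fixes W :: "'w set" and R v
  assumes model: "crisp_model W R v"
begin

lemma eval_Box_lower: "(w, u) \<in> R \<Longrightarrow> eval R v (\<box> \<phi>) w \<le> eval R v \<phi> u"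
  using eval_bounds[OF model] model by (fastforce simp: crisp_model_def intro!: inf01_lower)

lemma eval_Box_greatest:
  "(\<And>u. (w, u) \<in> R \<Longrightarrow> c \<le> eval R v \<phi> u) \<Longrightarrow> c \<le> 1 \<Longrightarrow> c \<le> eval R v (\<box> \<phi>) w"
  by (auto intro!: inf01_greatest)

lemma eval_Dia_upper: "(w, u) \<in> R \<Longrightarrow> eval R v \<phi> u \<le> eval R v (\<diamond> \<phi>) w"
  using eval_bounds[OF model] model by (fastforce simp: crisp_model_def intro!: sup01_upper)

lemma eval_Dia_least:
  "(\<And>u. (w, u) \<in> R \<Longrightarrow> eval R v \<phi> u \<le> c) \<Longrightarrow> 0 \<le> c \<Longrightarrow> eval R v (\<diamond> \<phi>) w \<le> c"
  by (auto intro!: sup01_least)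

lemma eval_Imp_eq_1:
  "w \<in> W \<Longrightarrow> eval R v (\<phi> \<^bold>\<rightarrow> \<chi>) w = 1 \<longleftrightarrow> eval R v \<phi> w \<le> eval R v \<chi> w"
  using eval_bounds[OF model, of w \<phi>] by (auto simp: g_imp_def)

text \<open>Implication is the residuum of the minimum on \<open>[0,1]\<close>. The axioms
  \<open>box_K\<close>, \<open>dia_imp\<close> and \<open>dia_box\<close> thereby reduce to
  inequalities between minima.\<close>

lemma eval_Imp_adjoint:
  "w \<in> W \<Longrightarrow> c \<le> 1 \<Longrightarrow>
    c \<le> eval R v (\<phi> \<^bold>\<rightarrow> \<chi>) w \<longleftrightarrow> min c (eval R v \<phi> w) \<le> eval R v \<chi> w"
  by (auto simp: g_imp_def min_def)

lemma modal_axiom_sound: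
  assumes "modal_axiom \<phi>" and w: "w \<in> W"
  shows "eval R v \<phi> w = 1"
proof -
  note b = eval_bounds[OF model]
  have R: "u \<in> W" if "(w, u) \<in> R" for u
    using that model by (auto simp: crisp_model_def)
  show ?thesis
    using assms(1)
  proof cases
    case dia_bot
    have "eval R v (\<diamond> \<^bold>0) w \<le> 0"
      by (rule eval_Dia_least) (auto simp: Bot_def Top_def g_imp_def g_neg_def)
    then have "eval R v (\<diamond> \<^bold>0) w = 0" using b[OF w] by (meson antisym)
    then show ?thesis using dia_bot by (simp add: g_neg_def del: eval.simps(8))
  next
    case (box_K \<psi> \<chi>)
    have "min (eval R v (\<box> (\<psi> \<^bold>\<rightarrow> \<chi>)) w) (eval R v (\<box> \<psi>) w) \<le> eval R v \<chi> u"
      if u: "(w, u) \<in> R" for u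
    proof -
      have "min (eval R v (\<box> (\<psi> \<^bold>\<rightarrow> \<chi>)) w) (eval R v \<psi> u) \<le> eval R v \<chi> u"
        using eval_Box_lower[OF u, of "\<psi> \<^bold>\<rightarrow> \<chi>"] eval_Imp_adjoint[OF R[OF u]] b[OF w] by blast
      then show ?thesis using eval_Box_lower[OF u, of \<psi>] by linarith
    qed
    then have "min (eval R v (\<box> (\<psi> \<^bold>\<rightarrow> \<chi>)) w) (eval R v (\<box> \<psi>) w) \<le> eval R v (\<box> \<chi>) w"
      by (rule eval_Box_greatest) (assumption | rule min.coboundedI2[OF conjunct2[OF b[OF w]]])+
    then have "eval R v (\<box> (\<psi> \<^bold>\<rightarrow> \<chi>)) w \<le> eval R v (\<box> \<psi> \<^bold>\<rightarrow> \<box> \<chi>) w"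
      using eval_Imp_adjoint[OF w] b[OF w] by blast
    then show ?thesis unfolding box_K using eval_Imp_eq_1[OF w] by blast
  next
    case (dia_disj \<psi> \<chi>)
    have "eval R v (\<diamond> (\<psi> \<^bold>\<or> \<chi>)) w \<le> eval R v (\<diamond> \<psi> \<^bold>\<or> \<diamond> \<chi>) w"
    proof (rule eval_Dia_least)
      fix u assume u: "(w, u) \<in> R"
      show "eval R v (\<psi> \<^bold>\<or> \<chi>) u \<le> eval R v (\<diamond> \<psi> \<^bold>\<or> \<diamond> \<chi>) w"
        using eval_Dia_upper[OF u, of \<psi>] eval_Dia_upper[OF u, of \<chi>] by (simp add: max_def)
    qed (use b[OF w] in blast)
    then show ?thesis unfolding dia_disj using eval_Imp_eq_1[OF w] by blast
  next
    case (dia_imp \<psi> \<chi>)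
    have "eval R v (\<diamond> (\<psi> \<^bold>\<rightarrow> \<chi>)) w \<le> eval R v (\<box> \<psi> \<^bold>\<rightarrow> \<diamond> \<chi>) w"
    proof (rule eval_Dia_least)
      fix u assume u: "(w, u) \<in> R"
      have "min (eval R v (\<psi> \<^bold>\<rightarrow> \<chi>) u) (eval R v \<psi> u) \<le> eval R v \<chi> u"
        using eval_Imp_adjoint[OF R[OF u]] b[OF R[OF u]] by blast
      then have "min (eval R v (\<psi> \<^bold>\<rightarrow> \<chi>) u) (eval R v (\<box> \<psi>) w) \<le> eval R v (\<diamond> \<chi>) w"
        using eval_Dia_upper[OF u, of \<chi>] eval_Box_lower[OF u, of \<psi>] by linarith
      then show "eval R v (\<psi> \<^bold>\<rightarrow> \<chi>) u \<le> eval R v (\<box> \<psi> \<^bold>\<rightarrow> \<diamond> \<chi>) w"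
        using eval_Imp_adjoint[OF w] b[OF R[OF u]] by blast
    qed (use b[OF w] in blast)
    then show ?thesis unfolding dia_imp using eval_Imp_eq_1[OF w] by blast
  next
    case (dia_box \<psi> \<chi>)
    have "eval R v (\<diamond> \<psi> \<^bold>\<rightarrow> \<box> \<chi>) w \<le> eval R v (\<box> (\<psi> \<^bold>\<rightarrow> \<chi>)) w"
    proof (rule eval_Box_greatest)
      fix u assume u: "(w, u) \<in> R"
      have "min (eval R v (\<diamond> \<psi> \<^bold>\<rightarrow> \<box> \<chi>) w) (eval R v (\<diamond> \<psi>) w) \<le> eval R v (\<box> \<chi>) w"
        using eval_Imp_adjoint[OF w] b[OF w] by blast
      then have "min (eval R v (\<diamond> \<psi> \<^bold>\<rightarrow> \<box> \<chi>) w) (eval R v \<psi> u) \<le> eval R v \<chi> u"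
        using eval_Dia_upper[OF u, of \<psi>] eval_Box_lower[OF u, of \<chi>] by linarith
      then show "eval R v (\<diamond> \<psi> \<^bold>\<rightarrow> \<box> \<chi>) w \<le> eval R v (\<psi> \<^bold>\<rightarrow> \<chi>) u"
        using eval_Imp_adjoint[OF R[OF u]] b[OF w] by blast
    qed (use b[OF w] in blast)
    then show ?thesis unfolding dia_box using eval_Imp_eq_1[OF w] by blast
  next
    case (dia_strict \<psi> \<chi>)
    \<comment> \<open>Either some successor separates the two formulas, and there the negated
      \<triangle> takes exactly the value 1, or \<psi> is pointwise below \<chi> and the antecedent
      has value 0.\<close>
    show ?thesis
    proof (cases "\<exists>u. (w, u) \<in> R \<and> eval R v \<chi> u < eval R v \<psi> u")
      case True
      then obtain u where u: "(w, u) \<in> R" "eval R v \<chi> u < eval R v \<psi> u" by blast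
      have "eval R v (\<^bold>\<sim> \<triangle> (\<psi> \<^bold>\<rightarrow> \<chi>)) u = 1"
        using u b[OF R[OF u(1)], of \<psi>] by (auto simp: g_neg_def g_delta_def g_imp_def)
      then have "1 \<le> eval R v (\<diamond> \<^bold>\<sim> \<triangle> (\<psi> \<^bold>\<rightarrow> \<chi>)) w"
        using eval_Dia_upper[OF u(1), of "\<^bold>\<sim> \<triangle> (\<psi> \<^bold>\<rightarrow> \<chi>)"] by simp
      then show ?thesis unfolding dia_strict using eval_Imp_eq_1[OF w] b[OF w] order_trans by blast
    next
      case False
      then have "eval R v (\<diamond> \<psi>) w \<le> eval R v (\<diamond> \<chi>) w"
      proof (intro eval_Dia_least)
        fix u assume u: "(w, u) \<in> R"
        then show "eval R v \<psi> u \<le> eval R v (\<diamond> \<chi>) w"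
          using False eval_Dia_upper[OF u, of \<chi>] by (meson not_less order_trans)
      qed (use b[OF w] in blast)
      then have "eval R v (\<diamond> \<psi> \<^bold>\<rightarrow> \<diamond> \<chi>) w = 1" using eval_Imp_eq_1[OF w] by blast
      then have "eval R v (\<^bold>\<sim> \<triangle> (\<diamond> \<psi> \<^bold>\<rightarrow> \<diamond> \<chi>)) w = 0"
        by (simp add: g_neg_def g_delta_def del: eval.simps(6,8))
      then show ?thesis unfolding dia_strict using eval_Imp_eq_1[OF w] b[OF w] by metis
    qed
  next
    case (crisp \<psi> \<chi>)
    have "eval R v (\<box> (\<psi> \<^bold>\<or> \<chi>)) w \<le> eval R v (\<box> \<psi> \<^bold>\<or> \<diamond> \<chi>) w"
    proof (cases "eval R v (\<box> (\<psi> \<^bold>\<or> \<chi>)) w \<le> eval R v (\<diamond> \<chi>) w")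
      case False
      \<comment> \<open>The value exceeds that of \<chi> at every successor, so the disjunction
        there can reach it only through \<psi>.\<close>
      have "eval R v (\<box> (\<psi> \<^bold>\<or> \<chi>)) w \<le> eval R v (\<box> \<psi>) w"
      proof (rule eval_Box_greatest)
        fix u assume u: "(w, u) \<in> R"
        show "eval R v (\<box> (\<psi> \<^bold>\<or> \<chi>)) w \<le> eval R v \<psi> u"
          using False eval_Dia_upper[OF u, of \<chi>] eval_Box_lower[OF u, of "\<psi> \<^bold>\<or> \<chi>"]
          by (simp add: max_def del: eval.simps(7,8) split: if_splits)
      qed (use b[OF w] in blast)
      then show ?thesis by (simp add: max_def del: eval.simps(7,8))
    qed (simp add: max_def del: eval.simps(7,8))
    then show ?thesis unfolding crisp using eval_Imp_eq_1[OF w] by blast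
  next
    case (delta_box \<psi>)
    have "eval R v (\<triangle> \<box> \<psi>) w \<le> eval R v (\<box> \<triangle> \<psi>) w"
    proof (cases "eval R v (\<box> \<psi>) w = 1")
      case True
      have "1 \<le> eval R v (\<box> \<triangle> \<psi>) w"
      proof (rule eval_Box_greatest)
        fix u assume u: "(w, u) \<in> R"
        show "1 \<le> eval R v (\<triangle> \<psi>) u"
          using True eval_Box_lower[OF u, of \<psi>] b[OF R[OF u], of \<psi>]
          by (simp add: g_delta_def del: eval.simps(7))
      qed simp
      then show ?thesis using b[OF w] order_trans by blast
    next
      case False
      then have "eval R v (\<triangle> \<box> \<psi>) w = 0" by (simp add: g_delta_def del: eval.simps(7))
      then show ?thesis using b[OF w] by metis
    qed
    then show ?thesis unfolding delta_box using eval_Imp_eq_1[OF w] by blast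
  qed
qed

lemma HKbiG_sound: "\<turnstile> \<phi> \<Longrightarrow> w \<in> W \<Longrightarrow> eval R v \<phi> w = 1"
proof (induction arbitrary: w rule: HKbiG.induct)
  case (biG \<phi>)
  then show ?case by (intro biG_axiom_sound[OF _ model])
next
  case (modal \<phi>)
  then show ?case by (intro modal_axiom_sound)
next
  case (mp \<phi> \<chi>)
  then have "1 \<le> eval R v \<chi> w" using eval_Imp_eq_1[of w \<phi> \<chi>] by metis
  then show ?case using eval_bounds[OF model mp.prems] by (meson antisym)
next
  case (delta_nec \<phi>)
  then show ?case by (simp add: g_delta_def)
next
  case (box_nec \<phi>)
  have "1 \<le> eval R v (\<box> \<phi>) w"
    using model box_nec.IH by (intro eval_Box_greatest) (auto simp: crisp_model_def)
  then show ?case using eval_bounds[OF model box_nec.prems] by (meson antisym)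
next
  case (dia_mono \<phi> \<chi>)
  have "eval R v (\<diamond> \<phi>) w \<le> eval R v (\<diamond> \<chi>) w"
  proof (rule eval_Dia_least)
    fix u assume u: "(w, u) \<in> R"
    then have "u \<in> W" using model by (auto simp: crisp_model_def)
    then have "eval R v \<phi> u \<le> eval R v \<chi> u" using dia_mono.IH eval_Imp_eq_1 by blast
    then show "eval R v \<phi> u \<le> eval R v (\<diamond> \<chi>) w" using eval_Dia_upper[OF u, of \<chi>] by linarith
  qed (use eval_bounds[OF model dia_mono.prems] in blast)
  then show ?case using eval_Imp_eq_1[OF dia_mono.prems] by blast
qed

end

section \<open>Theories closed under modus ponens and necessitation for \<open>\<triangle>\<close>\<close>

locale delta_theory =
  fixes T :: "fm set"
  assumes provable: "\<turnstile> \<phi> \<Longrightarrow> \<phi> \<in> T"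
    and mp: "\<phi> \<in> T \<Longrightarrow> \<phi> \<^bold>\<rightarrow> \<chi> \<in> T \<Longrightarrow> \<chi> \<in> T"
    and delta: "\<phi> \<in> T \<Longrightarrow> \<triangle> \<phi> \<in> T"
begin

lemma ax: "biG_axiom \<phi> \<Longrightarrow> \<phi> \<in> T"
  and modal_ax: "modal_axiom \<phi> \<Longrightarrow> \<phi> \<in> T"
  by (auto intro: provable HKbiG.intros)

lemma le_trans: "a \<^bold>\<rightarrow> b \<in> T \<Longrightarrow> b \<^bold>\<rightarrow> c \<in> T \<Longrightarrow> a \<^bold>\<rightarrow> c \<in> T"
  by (rule mp[OF _ mp[OF _ ax[OF biG_axiom.trans]]])

lemma le_conjE1: "a \<^bold>\<and> b \<^bold>\<rightarrow> a \<in> T"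
  and le_conjE2: "a \<^bold>\<and> b \<^bold>\<rightarrow> b \<in> T"
  and le_disjI1: "a \<^bold>\<rightarrow> a \<^bold>\<or> b \<in> T"
  and le_disjI2: "b \<^bold>\<rightarrow> a \<^bold>\<or> b \<in> T"
  and bot_le: "\<^bold>0 \<^bold>\<rightarrow> a \<in> T"
  by (auto intro: ax biG_axiom.intros)

lemma residuation: "a \<^bold>\<rightarrow> (b \<^bold>\<rightarrow> c) \<in> T \<longleftrightarrow> a \<^bold>\<and> b \<^bold>\<rightarrow> c \<in> T"
  by (blast intro: mp[OF _ ax[OF biG_axiom.curry]] mp[OF _ ax[OF biG_axiom.uncurry]])

lemma weaken: "b \<in> T \<Longrightarrow> a \<^bold>\<rightarrow> b \<in> T"
  by (erule mp) (simp add: residuation le_conjE1)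

text \<open>Identity is not an axiom. Currying the second projection gives
  \<open>c \<rightarrow> (a \<rightarrow> a)\<close> for every \<open>c\<close>, and
  \<open>c\<close> is taken to be a formula already known to lie in \<open>T\<close>.\<close>

lemma le_refl: "a \<^bold>\<rightarrow> a \<in> T"
  by (rule mp[OF bot_le[of a]]) (simp add: residuation le_conjE2)

lemma le_conjI: "a \<^bold>\<rightarrow> b \<in> T \<Longrightarrow> a \<^bold>\<rightarrow> c \<in> T \<Longrightarrow> a \<^bold>\<rightarrow> b \<^bold>\<and> c \<in> T"
  by (rule mp[OF _ mp[OF _ ax[OF biG_axiom.conjI]]])

lemma disj_leI: "a \<^bold>\<rightarrow> c \<in> T \<Longrightarrow> b \<^bold>\<rightarrow> c \<in> T \<Longrightarrow> a \<^bold>\<or> b \<^bold>\<rightarrow> c \<in> T"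
  by (rule mp[OF _ mp[OF _ ax[OF biG_axiom.disjE]]])

lemma Top_mem: "\<^bold>1 \<in> T"
  unfolding Top_def by (rule le_refl)

lemma Top_le_iff: "\<^bold>1 \<^bold>\<rightarrow> a \<in> T \<longleftrightarrow> a \<in> T"
  by (blast intro: mp[OF Top_mem] weaken)

lemma le_weaken: "a \<^bold>\<rightarrow> (b \<^bold>\<rightarrow> a) \<in> T"
  by (simp add: residuation le_conjE1)

lemma le_mp: "c \<^bold>\<rightarrow> a \<in> T \<Longrightarrow> c \<^bold>\<rightarrow> (a \<^bold>\<rightarrow> b) \<in> T \<Longrightarrow> c \<^bold>\<rightarrow> b \<in> T"
  by (rule le_trans[OF le_conjI[OF le_refl, of c a]]) (simp_all add: residuation)

lemma imp_mono: "b \<^bold>\<rightarrow> c \<in> T \<Longrightarrow> (a \<^bold>\<rightarrow> b) \<^bold>\<rightarrow> (a \<^bold>\<rightarrow> c) \<in> T"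
  by (rule residuation[THEN iffD2], rule le_trans[OF le_mp[OF le_conjE2 le_conjE1]])

lemma imp_antimono: "b \<^bold>\<rightarrow> a \<in> T \<Longrightarrow> (a \<^bold>\<rightarrow> c) \<^bold>\<rightarrow> (b \<^bold>\<rightarrow> c) \<in> T"
  by (rule residuation[THEN iffD2], rule le_mp[OF le_trans[OF le_conjE2] le_conjE1])

lemma contrapos: "a \<^bold>\<rightarrow> b \<in> T \<Longrightarrow> \<^bold>\<sim> b \<^bold>\<rightarrow> \<^bold>\<sim> a \<in> T"
  by (erule mp) (rule ax[OF biG_axiom.contrapos])

text \<open>\<open>Bot\<close> is the negation of \<open>Top\<close>, and \<open>a\<close> implies
  \<open>Top \<rightarrow> a\<close>; contraposing the latter gives
  \<open>\<sim> a \<rightarrow> Bot\<close>. It remains to exchange the two antecedents.\<close>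

lemma neg_le: "\<^bold>\<sim> a \<^bold>\<rightarrow> (a \<^bold>\<rightarrow> \<^bold>0) \<in> T"
proof -
  have "a \<^bold>\<rightarrow> (\<^bold>\<sim> a \<^bold>\<rightarrow> \<^bold>0) \<in> T"
    unfolding Bot_def by (rule le_trans[OF le_weaken ax[OF biG_axiom.contrapos]])
  then have "a \<^bold>\<and> \<^bold>\<sim> a \<^bold>\<rightarrow> \<^bold>0 \<in> T" by (rule residuation[THEN iffD1])
  then show ?thesis
    by (rule residuation[THEN iffD2, OF le_trans[OF le_conjI[OF le_conjE2 le_conjE1]]])
qed

text \<open>The axiom \<open>dia_bot\<close> supplies a negation to start from: contraposing
  \<open>Bot \<rightarrow> \<diamond> Bot\<close> carries \<open>\<sim> \<diamond> Bot\<close> to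
  the claim. Together with \<open>neg_le\<close>, the next lemma then identifies
  \<open>\<sim> a\<close> with \<open>a \<rightarrow> Bot\<close>.\<close>

lemma neg_Bot: "\<^bold>\<sim> \<^bold>0 \<in> T"
  by (rule mp[OF modal_ax[OF dia_bot] contrapos[OF bot_le]])

lemma le_neg: "(a \<^bold>\<rightarrow> \<^bold>0) \<^bold>\<rightarrow> \<^bold>\<sim> a \<in> T"
  by (rule le_mp[OF weaken[OF neg_Bot] ax[OF biG_axiom.contrapos]])

lemma delta_le: "\<triangle> a \<^bold>\<rightarrow> a \<in> T"
  by (auto intro: ax biG_axiom.intros)

lemma disj_mono: "a \<^bold>\<rightarrow> c \<in> T \<Longrightarrow> b \<^bold>\<rightarrow> d \<in> T \<Longrightarrow> a \<^bold>\<or> b \<^bold>\<rightarrow> c \<^bold>\<or> d \<in> T"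
  by (intro disj_leI le_trans[OF _ le_disjI1] le_trans[OF _ le_disjI2])

text \<open>Adjoining \<open>a\<close> to the theory (the deduction theorem for \<open>\<triangle>\<close>).\<close>

lemma delta_theory_extend: "delta_theory {b. \<triangle> a \<^bold>\<rightarrow> b \<in> T}"
proof
  show "b \<in> {b. \<triangle> a \<^bold>\<rightarrow> b \<in> T}" if "\<turnstile> b" for b
    using that provable weaken by blast
  show "c \<in> {b. \<triangle> a \<^bold>\<rightarrow> b \<in> T}"
    if "b \<in> {b. \<triangle> a \<^bold>\<rightarrow> b \<in> T}" "b \<^bold>\<rightarrow> c \<in> {b. \<triangle> a \<^bold>\<rightarrow> b \<in> T}" for b c
    using that le_mp by blast
  \<comment> \<open>Necessitation and \<open>delta_K\<close> give
    \<open>\<triangle> \<triangle> a \<rightarrow> \<triangle> b\<close>; \<open>delta_4\<close>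
    shortens the antecedent to \<open>\<triangle> a\<close>.\<close>
  show "\<triangle> b \<in> {b. \<triangle> a \<^bold>\<rightarrow> b \<in> T}" if "b \<in> {b. \<triangle> a \<^bold>\<rightarrow> b \<in> T}" for b
    using that delta ax[OF biG_axiom.delta_K] ax[OF biG_axiom.delta_4] mp le_trans by blast
qed

end

lemma delta_theory_HKbiG: "delta_theory {\<phi>. \<turnstile> \<phi>}"
  by unfold_locales (auto intro: HKbiG.intros)

lemma box_mono:
  assumes "\<turnstile> a \<^bold>\<rightarrow> b" and "delta_theory T"
  shows "\<box> a \<^bold>\<rightarrow> \<box> b \<in> T"
  using delta_theory.modal_ax[OF assms(2) box_K] delta_theory.mp[OF assms(2)]
    delta_theory.provable[OF assms(2) HKbiG.box_nec[OF assms(1)]] by blast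

section \<open>Prime theories and the linear order they induce\<close>

locale prime_theory = delta_theory +
  assumes prime: "a \<^bold>\<or> b \<in> T \<Longrightarrow> a \<in> T \<or> b \<in> T"
    and Bot_notin: "\<^bold>0 \<notin> T"
begin

lemma le_total: "a \<^bold>\<rightarrow> b \<in> T \<or> b \<^bold>\<rightarrow> a \<in> T"
  by (rule prime[OF ax[OF prelin]])

text \<open>By contraction \<open>a\<close> is not below \<open>a \<rightarrow> b\<close>, so
  linearity puts \<open>a \<rightarrow> b\<close> below \<open>a\<close>, and detaching under this
  antecedent gives \<open>b\<close>. With \<open>le_weaken\<close>, an implication that fails is
  equivalent to its consequent, as for the values in \<open>g_imp\<close>.\<close>

lemma imp_notin: "a \<^bold>\<rightarrow> b \<notin> T \<Longrightarrow> (a \<^bold>\<rightarrow> b) \<^bold>\<rightarrow> b \<in> T"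
proof -
  assume *: "a \<^bold>\<rightarrow> b \<notin> T"
  then have "a \<^bold>\<rightarrow> (a \<^bold>\<rightarrow> b) \<notin> T" using le_mp[OF le_refl] by blast
  then have "(a \<^bold>\<rightarrow> b) \<^bold>\<rightarrow> a \<in> T" using le_total by blast
  then show ?thesis using le_mp le_refl by blast
qed

text \<open>By linearity one conjunct is below the other, and that one lies below the
  conjunction.\<close>

lemma conj_le: "a \<^bold>\<and> b \<^bold>\<rightarrow> c \<in> T \<Longrightarrow> a \<^bold>\<rightarrow> c \<in> T \<or> b \<^bold>\<rightarrow> c \<in> T"
  using le_total[of a b] le_trans[OF le_conjI[OF le_refl]] le_trans[OF le_conjI[OF _ le_refl]] by blast

lemma le_disj: "c \<^bold>\<rightarrow> a \<^bold>\<or> b \<in> T \<Longrightarrow> c \<^bold>\<rightarrow> a \<in> T \<or> c \<^bold>\<rightarrow> b \<in> T"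
  using le_total[of a b] le_trans[OF _ disj_leI[OF le_refl]] le_trans[OF _ disj_leI[OF _ le_refl]] by blast

lemma delta_notin: "a \<notin> T \<Longrightarrow> \<^bold>\<sim> \<triangle> a \<in> T"
  using prime[OF ax[OF delta_em]] mp[OF _ delta_le] by blast

lemma Dia_Bot_notin: "\<diamond> \<^bold>0 \<notin> T"
  using mp[OF _ mp[OF modal_ax[OF dia_bot] neg_le]] Bot_notin by blast

end

text \<open>Zorn's lemma gives a maximal theory that avoids \<open>J\<close>. It is prime: adjoining
  either of two missing disjuncts would yield an element of \<open>J\<close>, and directedness
  merges these two elements into one.\<close>

lemma prime_theory_exists:
  assumes S: "delta_theory S" and disj: "S \<inter> J = {}" and ne: "J \<noteq> {}"
    and dir: "\<And>i j. i \<in> J \<Longrightarrow> j \<in> J \<Longrightarrow> \<exists>k\<in>J. \<turnstile> i \<^bold>\<or> j \<^bold>\<rightarrow> k"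
  shows "\<exists>T. prime_theory T \<and> S \<subseteq> T \<and> T \<inter> J = {}"
proof -
  let ?A = "{T. delta_theory T \<and> S \<subseteq> T \<and> T \<inter> J = {}}"
  have "\<exists>M\<in>?A. \<forall>X\<in>?A. M \<subseteq> X \<longrightarrow> X = M"
  proof (rule subset_Zorn_nonempty)
    show "?A \<noteq> {}" using S disj by blast
    fix C assume C: "C \<noteq> {}" "subset.chain ?A C"
    have "delta_theory (\<Union>C)"
    proof
      show "a \<in> \<Union>C" if "\<turnstile> a" for a
        using C that delta_theory.provable by (fastforce simp: subset_chain_def)
      show "\<triangle> a \<in> \<Union>C" if "a \<in> \<Union>C" for a
        using C that delta_theory.delta by (fastforce simp: subset_chain_def)
      fix a b assume "a \<in> \<Union>C" "a \<^bold>\<rightarrow> b \<in> \<Union>C"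
      then obtain X Y where X: "X \<in> C" "a \<in> X" and Y: "Y \<in> C" "a \<^bold>\<rightarrow> b \<in> Y" by blast
      have XY: "delta_theory X" "delta_theory Y"
        using C(2) X(1) Y(1) by (auto simp: subset_chain_def)
      have "X \<subseteq> Y \<or> Y \<subseteq> X" using C(2) X(1) Y(1) by (auto simp: subset_chain_def)
      then have "b \<in> X \<or> b \<in> Y"
      proof
        assume "X \<subseteq> Y"
        with X(2) have "a \<in> Y" by blast
        from delta_theory.mp[OF XY(2) this Y(2)] show ?thesis ..
      next
        assume "Y \<subseteq> X"
        with Y(2) have "a \<^bold>\<rightarrow> b \<in> X" by blast
        from delta_theory.mp[OF XY(1) X(2) this] show ?thesis ..
      qed
      then show "b \<in> \<Union>C" using X(1) Y(1) by blast
    qed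
    moreover have "X \<in> ?A" if "X \<in> C" for X using C(2) that by (auto simp: subset_chain_def)
    ultimately show "\<Union>C \<in> ?A" using C(1) by blast
  qed
  then obtain T where "T \<in> ?A" and maximal: "\<forall>X\<in>?A. T \<subseteq> X \<longrightarrow> X = T" by (rule bexE)
  then have T: "delta_theory T" "S \<subseteq> T" "T \<inter> J = {}" by simp_all
  have max: "X = T" if "delta_theory X" "T \<subseteq> X" "X \<inter> J = {}" for X
  proof -
    have "X \<in> ?A" using that T(2) by simp
    from bspec[OF maximal this] that(2) show ?thesis by simp
  qed
  interpret delta_theory T by fact
  \<comment> \<open>Otherwise adjoining \<open>a\<close> gives a theory that still avoids
    \<open>J\<close>, and maximality puts \<open>a\<close> into \<open>T\<close>.\<close>
  have ext: "\<exists>j\<in>J. \<triangle> a \<^bold>\<rightarrow> j \<in> T" if "a \<notin> T" for a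
  proof (rule ccontr)
    assume "\<not> ?thesis"
    then have "{b. \<triangle> a \<^bold>\<rightarrow> b \<in> T} = T"
      using weaken by (intro max delta_theory_extend) blast+
    then show False using delta_le that by blast
  qed
  have "prime_theory T"
  proof
    show "\<^bold>0 \<notin> T" using ne T(3) bot_le mp by blast
    fix a b assume ab: "a \<^bold>\<or> b \<in> T"
    show "a \<in> T \<or> b \<in> T"
    proof (rule ccontr)
      assume "\<not> ?thesis"
      then obtain i j where ij: "i \<in> J" "j \<in> J" "\<triangle> a \<^bold>\<rightarrow> i \<in> T" "\<triangle> b \<^bold>\<rightarrow> j \<in> T"
        using ext by blast
      \<comment> \<open>The antecedents produced by \<open>ext\<close> carry a \<triangle>, so the
        disjunction has to be necessitated and then split by \<open>delta_disj\<close>.\<close>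
      have "\<triangle> a \<^bold>\<or> \<triangle> b \<in> T" using ab delta ax[OF delta_disj] mp by blast
      then have "i \<^bold>\<or> j \<in> T" using disj_mono[OF ij(3,4)] mp by blast
      then show False using dir[OF ij(1,2)] T(3) provable mp by blast
    qed
  qed
  then show ?thesis using T by blast
qed

section \<open>Successors of a prime theory and witnesses for the modalities\<close>

context prime_theory
begin

lemma delta_theory_Box: "delta_theory {a. \<box> a \<in> T}"
proof
  show "a \<in> {a. \<box> a \<in> T}" if "\<turnstile> a" for a using that provable HKbiG.box_nec by blast
  show "b \<in> {a. \<box> a \<in> T}" if "a \<in> {a. \<box> a \<in> T}" "a \<^bold>\<rightarrow> b \<in> {a. \<box> a \<in> T}" for a b
    using that modal_ax[OF box_K] mp by blast
  show "\<triangle> a \<in> {a. \<box> a \<in> T}" if "a \<in> {a. \<box> a \<in> T}" for a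
    using that modal_ax[OF delta_box] mp delta by blast
qed

lemma Dia_mono: "\<turnstile> a \<^bold>\<rightarrow> b \<Longrightarrow> \<diamond> a \<in> T \<Longrightarrow> \<diamond> b \<in> T"
  by (erule mp[OF _ provable[OF HKbiG.dia_mono]])

lemma Dia_disj: "\<diamond> (a \<^bold>\<or> b) \<in> T \<Longrightarrow> \<diamond> a \<in> T \<or> \<diamond> b \<in> T"
  by (rule prime) (erule mp[OF _ modal_ax[OF dia_disj]])

lemma Box_disj: "\<box> (a \<^bold>\<or> b) \<in> T \<Longrightarrow> \<diamond> a \<in> T \<or> \<box> b \<in> T"
proof -
  assume *: "\<box> (a \<^bold>\<or> b) \<in> T"
  have "\<turnstile> a \<^bold>\<or> b \<^bold>\<rightarrow> b \<^bold>\<or> a"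
    using delta_theory.disj_leI[OF delta_theory_HKbiG] delta_theory.le_disjI1[OF delta_theory_HKbiG]
      delta_theory.le_disjI2[OF delta_theory_HKbiG] by blast
  then have "\<box> (b \<^bold>\<or> a) \<in> T" using * mp box_mono[OF _ delta_theory_axioms] by blast
  then show ?thesis using modal_ax[OF modal_axiom.crisp] mp prime by blast
qed

lemma Box_conj: "\<box> a \<^bold>\<and> \<box> b \<^bold>\<rightarrow> \<box> (a \<^bold>\<and> b) \<in> T"
proof -
  have "\<turnstile> a \<^bold>\<rightarrow> (b \<^bold>\<rightarrow> a \<^bold>\<and> b)"
    using delta_theory.residuation[OF delta_theory_HKbiG] delta_theory.le_refl[OF delta_theory_HKbiG]
    by blast
  then have "\<box> a \<^bold>\<rightarrow> \<box> (b \<^bold>\<rightarrow> a \<^bold>\<and> b) \<in> T" using box_mono[OF _ delta_theory_axioms] by blast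
  then have "\<box> a \<^bold>\<rightarrow> (\<box> b \<^bold>\<rightarrow> \<box> (a \<^bold>\<and> b)) \<in> T" using modal_ax[OF box_K] le_trans by blast
  then show ?thesis using residuation by blast
qed

definition successor :: "fm set \<Rightarrow> bool" where
  "successor U \<longleftrightarrow> prime_theory U \<and> (\<forall>a. \<box> a \<in> T \<longrightarrow> a \<in> U) \<and> (\<forall>a\<in>U. \<diamond> a \<in> T)"

text \<open>The disjunctions of some \<open>a\<close> with \<open>\<diamond> a\<close> outside
  \<open>T\<close> and some member of \<open>P\<close> form a single directed family, and avoiding
  it excludes both kinds of formulas at once. By \<open>Box_disj\<close>, the box of such a
  disjunction is never in \<open>T\<close>.\<close>

lemma successor_exists:
  assumes ne: "P \<noteq> {}" and P: "\<And>c. c \<in> P \<Longrightarrow> \<box> c \<notin> T"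
    and dir: "\<And>c d. c \<in> P \<Longrightarrow> d \<in> P \<Longrightarrow> \<exists>k\<in>P. \<turnstile> c \<^bold>\<or> d \<^bold>\<rightarrow> k"
  shows "\<exists>U. successor U \<and> U \<inter> P = {}"
proof -
  interpret H: delta_theory "{\<phi>. \<turnstile> \<phi>}" by (rule delta_theory_HKbiG)
  let ?J = "{a \<^bold>\<or> c |a c. \<diamond> a \<notin> T \<and> c \<in> P}"
  have "\<exists>U. prime_theory U \<and> {a. \<box> a \<in> T} \<subseteq> U \<and> U \<inter> ?J = {}"
  proof (rule prime_theory_exists[OF delta_theory_Box])
    show "{a. \<box> a \<in> T} \<inter> ?J = {}" using Box_disj P by blast
    show "?J \<noteq> {}" using ne Dia_Bot_notin by blast
    fix i j assume "i \<in> ?J" "j \<in> ?J"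
    then obtain a b c d where ij: "i = a \<^bold>\<or> c" "j = b \<^bold>\<or> d"
      and ab: "\<diamond> a \<notin> T" "\<diamond> b \<notin> T" and cd: "c \<in> P" "d \<in> P" by blast
    from dir[OF cd] obtain k where k: "k \<in> P" "\<turnstile> c \<^bold>\<or> d \<^bold>\<rightarrow> k" by blast
    have "\<turnstile> a \<^bold>\<or> c \<^bold>\<rightarrow> (a \<^bold>\<or> b) \<^bold>\<or> k" "\<turnstile> b \<^bold>\<or> d \<^bold>\<rightarrow> (a \<^bold>\<or> b) \<^bold>\<or> k"
      using H.disj_mono[of a "a \<^bold>\<or> b" c k] H.disj_mono[of b "a \<^bold>\<or> b" d k]
        H.le_disjI1[of a b] H.le_disjI2[of b a] H.le_trans[of c "c \<^bold>\<or> d" k] H.le_trans[of d "c \<^bold>\<or> d" k]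
        H.le_disjI1[of c d] H.le_disjI2[of d c] k by auto
    then have "\<turnstile> i \<^bold>\<or> j \<^bold>\<rightarrow> (a \<^bold>\<or> b) \<^bold>\<or> k" using ij H.disj_leI by blast
    then show "\<exists>k\<in>?J. \<turnstile> i \<^bold>\<or> j \<^bold>\<rightarrow> k" using Dia_disj ab k(1) by blast
  qed
  then obtain U where U: "prime_theory U" "{a. \<box> a \<in> T} \<subseteq> U" "U \<inter> ?J = {}" by blast
  interpret U: prime_theory U by fact
  \<comment> \<open>Any member of \<open>P\<close> completes \<open>a\<close> to an element of
    \<open>?J\<close>; in the next claim \<open>Bot\<close> is the other disjunct.\<close>
  have "\<diamond> a \<in> T" if "a \<in> U" for a
    using that U(3) ne U.le_disjI1 U.mp by blast
  moreover have "c \<notin> U" if "c \<in> P" for c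
    using that U(3) Dia_Bot_notin U.le_disjI2 U.mp by blast
  ultimately show ?thesis unfolding successor_def using U by blast
qed

text \<open>In \<open>U\<close>, only formulas whose box is below \<open>\<box> a\<close> can be
  below \<open>a\<close>, so the lower bounds imposed by boxes never push \<open>a\<close> above the
  value of \<open>\<box> a\<close>. The forbidden formulas are directed because
  \<open>b \<rightarrow> a\<close> and \<open>b' \<rightarrow> a\<close> each imply
  \<open>b \<and> b' \<rightarrow> a\<close>.\<close>

lemma Box_witness:
  assumes "\<box> a \<notin> T"
  shows "\<exists>U. successor U \<and> (\<forall>b. b \<^bold>\<rightarrow> a \<in> U \<longrightarrow> \<box> b \<^bold>\<rightarrow> \<box> a \<in> T)"
proof -
  interpret H: delta_theory "{\<phi>. \<turnstile> \<phi>}" by (rule delta_theory_HKbiG)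
  let ?P = "{b \<^bold>\<rightarrow> a |b. \<box> b \<^bold>\<rightarrow> \<box> a \<notin> T}"
  have "\<exists>U. successor U \<and> U \<inter> ?P = {}"
  proof (rule successor_exists)
    \<comment> \<open>This makes \<open>Top \<rightarrow> a\<close> a member of
      \<open>?P\<close>.\<close>
    have "\<box> \<^bold>1 \<in> T" using H.Top_mem HKbiG.box_nec provable by blast
    then show "?P \<noteq> {}" using assms mp by blast
    show "\<box> c \<notin> T" if "c \<in> ?P" for c using that modal_ax[OF box_K] mp by blast
    fix c d assume "c \<in> ?P" "d \<in> ?P"
    then obtain b b' where bb: "c = b \<^bold>\<rightarrow> a" "d = b' \<^bold>\<rightarrow> a"
      "\<box> b \<^bold>\<rightarrow> \<box> a \<notin> T" "\<box> b' \<^bold>\<rightarrow> \<box> a \<notin> T" by blast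
    then have "\<box> (b \<^bold>\<and> b') \<^bold>\<rightarrow> \<box> a \<notin> T" using conj_le Box_conj le_trans by blast
    moreover have "\<turnstile> c \<^bold>\<or> d \<^bold>\<rightarrow> (b \<^bold>\<and> b' \<^bold>\<rightarrow> a)"
      unfolding bb using H.disj_leI H.imp_antimono H.le_conjE1 H.le_conjE2 by blast
    ultimately show "\<exists>k\<in>?P. \<turnstile> c \<^bold>\<or> d \<^bold>\<rightarrow> k" by blast
  qed
  then show ?thesis by blast
qed

text \<open>Dually, the upper bounds imposed by diamonds never push \<open>a\<close> below the value
  of \<open>\<diamond> a\<close>. Directedness now comes from
  \<open>a \<rightarrow> b \<or> b'\<close>.\<close>

lemma Dia_witness:
  assumes "\<diamond> a \<^bold>\<rightarrow> \<^bold>0 \<notin> T"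
  shows "\<exists>U. successor U \<and> (\<forall>b. a \<^bold>\<rightarrow> b \<in> U \<longrightarrow> \<diamond> a \<^bold>\<rightarrow> \<diamond> b \<in> T)"
proof -
  interpret H: delta_theory "{\<phi>. \<turnstile> \<phi>}" by (rule delta_theory_HKbiG)
  let ?P = "{a \<^bold>\<rightarrow> b |b. \<diamond> a \<^bold>\<rightarrow> \<diamond> b \<notin> T}"
  have "\<exists>U. successor U \<and> U \<inter> ?P = {}"
  proof (rule successor_exists)
    have "\<diamond> \<^bold>0 \<^bold>\<rightarrow> \<^bold>0 \<in> T" using modal_ax[OF dia_bot] neg_le mp by blast
    then show "?P \<noteq> {}" using assms le_trans by blast
    show "\<box> c \<notin> T" if "c \<in> ?P" for c
    proof
      assume "\<box> c \<in> T"
      \<comment> \<open>\<open>dia_strict\<close> gives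
        \<open>\<diamond> \<sim> \<triangle> c\<close>. By \<open>dia_imp\<close>, this and
        \<open>\<box> \<triangle> c\<close> would together put \<open>\<diamond> Bot\<close> into
        \<open>T\<close>.\<close>
      then have *: "\<box> \<triangle> c \<in> T" using modal_ax[OF delta_box] mp delta by blast
      from that obtain b where b: "c = a \<^bold>\<rightarrow> b" "\<diamond> a \<^bold>\<rightarrow> \<diamond> b \<notin> T" by blast
      have "\<diamond> \<^bold>\<sim> \<triangle> c \<in> T"
        unfolding b(1) using delta_notin[OF b(2)] modal_ax[OF dia_strict] mp by blast
      then have "\<diamond> (\<triangle> c \<^bold>\<rightarrow> \<^bold>0) \<in> T" using Dia_mono H.neg_le by blast
      then show False using * modal_ax[OF dia_imp] mp Dia_Bot_notin by blast
    qed
    fix c d assume "c \<in> ?P" "d \<in> ?P"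
    then obtain b b' where bb: "c = a \<^bold>\<rightarrow> b" "d = a \<^bold>\<rightarrow> b'"
      "\<diamond> a \<^bold>\<rightarrow> \<diamond> b \<notin> T" "\<diamond> a \<^bold>\<rightarrow> \<diamond> b' \<notin> T" by blast
    then have "\<diamond> a \<^bold>\<rightarrow> \<diamond> (b \<^bold>\<or> b') \<notin> T" using le_disj modal_ax[OF dia_disj] le_trans by blast
    moreover have "\<turnstile> c \<^bold>\<or> d \<^bold>\<rightarrow> (a \<^bold>\<rightarrow> b \<^bold>\<or> b')"
      unfolding bb using H.disj_leI H.imp_mono H.le_disjI1 H.le_disjI2 by blast
    ultimately show "\<exists>k\<in>?P. \<turnstile> c \<^bold>\<or> d \<^bold>\<rightarrow> k" by blast
  qed
  then show ?thesis by blast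
qed

end

section \<open>Realising a finite preorder by reals within bounds\<close>

text \<open>The solution is the least function on \<open>A\<close> above \<open>lo\<close> that
  rises by at least \<open>d\<close> times every rise of \<open>r\<close>. A positive slope
  \<open>d\<close> makes it reflect the order, and a small one keeps it below
  \<open>up\<close>.\<close>

lemma order_embedding_within_bounds:
  fixes r lo up :: "'a \<Rightarrow> real"
  assumes fin: "finite A"
    and weak: "\<And>x y. x \<in> A \<Longrightarrow> y \<in> A \<Longrightarrow> r x \<le> r y \<Longrightarrow> lo x \<le> up y"
    and strict: "\<And>x y. x \<in> A \<Longrightarrow> y \<in> A \<Longrightarrow> r x < r y \<Longrightarrow> lo x < up y"
  shows "\<exists>f. \<forall>x\<in>A. lo x \<le> f x \<and> f x \<le> up x \<and> (\<forall>y\<in>A. f x \<le> f y \<longleftrightarrow> r x \<le> r y)"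
proof -
  \<comment> \<open>These are the slopes that the strictly increasing pairs permit, all positive by
    \<open>strict\<close>; the element 1 keeps the set nonempty.\<close>
  define D where "D = insert 1 ((\<lambda>(x, y). (up y - lo x) / (r y - r x)) `
    {(x, y) \<in> A \<times> A. r x < r y})"
  have D: "finite D" "D \<noteq> {}"
    using fin by (auto simp: D_def intro: finite_subset[of _ "A \<times> A"])
  define d where "d = Min D"
  have "\<forall>t\<in>D. 0 < t" using strict by (auto simp: D_def)
  then have d: "0 < d" unfolding d_def using D by simp
  have d_le: "lo x + d * (r y - r x) \<le> up y" if "x \<in> A" "y \<in> A" "r x \<le> r y" for x y
  proof (cases "r x = r y")
    case False
    then have "(up y - lo x) / (r y - r x) \<in> D"
      using that unfolding D_def by (intro insertI2 image_eqI[of _ _ "(x, y)"]) auto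
    then have "d \<le> (up y - lo x) / (r y - r x)" unfolding d_def using D by simp
    then show ?thesis using that False by (simp add: pos_le_divide_eq algebra_simps)
  qed (use weak that in simp)
  \<comment> \<open>Each lower bound at or below \<open>x\<close> is carried to \<open>x\<close>
    along slope \<open>d\<close>; the choice \<open>y = x\<close> contributes \<open>lo x\<close>
    itself.\<close>
  define B where "B x = (\<lambda>y. lo y + d * (r x - r y)) ` {y \<in> A. r y \<le> r x}" for x
  define f where "f x = Max (B x)" for x
  have B: "finite (B x)" for x using fin by (simp add: B_def)
  have lo: "lo x \<in> B x" if "x \<in> A" for x
    using that unfolding B_def by (intro image_eqI[of _ _ x]) auto
  have up: "f x \<le> up x" if "x \<in> A" for x
    unfolding f_def using lo[OF that] d_le that by (subst Max_le_iff[OF B]) (auto simp: B_def)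
  have mono: "f x + d * (r y - r x) \<le> f y" if "x \<in> A" "r x \<le> r y" for x y
  proof -
    have "f x \<in> B x" unfolding f_def using B lo[OF that(1)] by (intro Max_in) auto
    then obtain z where z: "z \<in> A" "r z \<le> r x" "f x = lo z + d * (r x - r z)"
      by (auto simp: B_def)
    then have "f x + d * (r y - r x) = lo z + d * (r y - r z)" by (simp add: algebra_simps)
    then have "f x + d * (r y - r x) \<in> B y"
      using z(1,2) that(2) unfolding B_def by (intro image_eqI[of _ _ z]) auto
    then show ?thesis unfolding f_def using B by simp
  qed
  have "f x \<le> f y \<longleftrightarrow> r x \<le> r y" if x: "x \<in> A" and y: "y \<in> A" for x y
  proof
    assume "r x \<le> r y"
    then have "0 \<le> d * (r y - r x)" using d by simp
    then show "f x \<le> f y" using mono[OF x \<open>r x \<le> r y\<close>] by linarith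
  next
    assume *: "f x \<le> f y"
    show "r x \<le> r y"
    proof (rule ccontr)
      assume "\<not> r x \<le> r y"
      then have "0 < d * (r x - r y)" "r y \<le> r x" using d by auto
      then show False using mono[OF y, of x] * by linarith
    qed
  qed
  moreover have "lo x \<le> f x" if "x \<in> A" for x unfolding f_def using B lo[OF that] by simp
  ultimately show ?thesis using up by blast
qed

section \<open>The canonical model\<close>

text \<open>The order of \<open>T\<close> on \<open>F\<close> is a total preorder, so the number of
  elements of \<open>F\<close> below \<open>x\<close> is a rank that represents it. By linearity,
  \<open>y \<rightarrow> x \<notin> T\<close> says that \<open>x\<close> is strictly below
  \<open>y\<close>.\<close>

lemma (in prime_theory) valuation_within_bounds:
  fixes lo up :: "fm \<Rightarrow> real"
  assumes fin: "finite F"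
    and weak: "\<And>x y. x \<in> F \<Longrightarrow> y \<in> F \<Longrightarrow> x \<^bold>\<rightarrow> y \<in> T \<Longrightarrow> lo x \<le> up y"
    and strict: "\<And>x y. x \<in> F \<Longrightarrow> y \<in> F \<Longrightarrow> y \<^bold>\<rightarrow> x \<notin> T \<Longrightarrow> lo x < up y"
  shows "\<exists>e. \<forall>x\<in>F. lo x \<le> e x \<and> e x \<le> up x \<and> (\<forall>y\<in>F. e x \<le> e y \<longleftrightarrow> x \<^bold>\<rightarrow> y \<in> T)"
proof -
  define D where "D x = {z \<in> F. z \<^bold>\<rightarrow> x \<in> T}" for x
  have D: "finite (D x)" for x using fin by (simp add: D_def)
  have D_mono: "D x \<subseteq> D y" if "x \<^bold>\<rightarrow> y \<in> T" for x y
    unfolding D_def using le_trans[OF _ that] by auto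
  have r: "real (card (D x)) \<le> real (card (D y)) \<longleftrightarrow> x \<^bold>\<rightarrow> y \<in> T" if "x \<in> F" "y \<in> F" for x y
  proof
    assume *: "real (card (D x)) \<le> real (card (D y))"
    show "x \<^bold>\<rightarrow> y \<in> T"
    proof (rule ccontr)
      assume n: "x \<^bold>\<rightarrow> y \<notin> T"
      then have "D y \<subseteq> D x" using le_total D_mono by blast
      moreover have "x \<in> D x" "x \<notin> D y" using that le_refl n by (auto simp: D_def)
      ultimately have "D y \<subset> D x" by blast
      from psubset_card_mono[OF D this] * show False by simp
    qed
  qed (simp add: card_mono[OF D D_mono])
  have "\<exists>e. \<forall>x\<in>F. lo x \<le> e x \<and> e x \<le> up x \<and>
      (\<forall>y\<in>F. e x \<le> e y \<longleftrightarrow> real (card (D x)) \<le> real (card (D y)))"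
    using fin
  proof (rule order_embedding_within_bounds)
    show "lo x \<le> up y" if "x \<in> F" "y \<in> F" "real (card (D x)) \<le> real (card (D y))" for x y
      using weak r that by blast
    show "lo x < up y" if "x \<in> F" "y \<in> F" "real (card (D x)) < real (card (D y))" for x y
      using strict[OF that(1,2)] r[OF that(2,1)] that(3) by linarith
  qed
  then show ?thesis using r by simp
qed

section \<open>Finite fragments and states over them\<close>

primrec subfms :: "fm \<Rightarrow> fm set" where
  "subfms (Var p) = {Var p}"
| "subfms (\<^bold>\<sim> a) = insert (\<^bold>\<sim> a) (subfms a)"
| "subfms (\<triangle> a) = insert (\<triangle> a) (subfms a)"
| "subfms (a \<^bold>\<and> b) = insert (a \<^bold>\<and> b) (subfms a \<union> subfms b)"
| "subfms (a \<^bold>\<or> b) = insert (a \<^bold>\<or> b) (subfms a \<union> subfms b)"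
| "subfms (a \<^bold>\<rightarrow> b) = insert (a \<^bold>\<rightarrow> b) (subfms a \<union> subfms b)"
| "subfms (\<box> a) = insert (\<box> a) (subfms a)"
| "subfms (\<diamond> a) = insert (\<diamond> a) (subfms a)"

lemma subfms_refl [simp]: "a \<in> subfms a"
  by (cases a) auto

lemma subfms_trans: "b \<in> subfms a \<Longrightarrow> subfms b \<subseteq> subfms a"
  by (induction a) auto

lemma finite_subfms: "finite (subfms a)"
  by (induction a) auto

text \<open>The four modal formulas force a successor valuation to map \<open>\<^bold>0\<close> to 0 and \<open>\<^bold>1\<close> to 1.\<close>

locale fragment =
  fixes F :: "fm set"
  assumes finite: "finite F"
    and subfms: "a \<in> F \<Longrightarrow> subfms a \<subseteq> F"
    and modal_consts: "\<box> \<^bold>0 \<in> F" "\<box> \<^bold>1 \<in> F" "\<diamond> \<^bold>0 \<in> F" "\<diamond> \<^bold>1 \<in> F"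
begin

lemma const_mem: "\<^bold>0 \<in> F" "\<^bold>1 \<in> F"
  using subfms[OF modal_consts(1)] subfms[OF modal_consts(2)] by auto

lemma closed:
  "\<^bold>\<sim> a \<in> F \<Longrightarrow> a \<in> F" "\<triangle> a \<in> F \<Longrightarrow> a \<in> F" "\<box> a \<in> F \<Longrightarrow> a \<in> F" "\<diamond> a \<in> F \<Longrightarrow> a \<in> F"
  "a \<^bold>\<and> b \<in> F \<Longrightarrow> a \<in> F \<and> b \<in> F" "a \<^bold>\<or> b \<in> F \<Longrightarrow> a \<in> F \<and> b \<in> F" "a \<^bold>\<rightarrow> b \<in> F \<Longrightarrow> a \<in> F \<and> b \<in> F"
  using subfms[of "\<^bold>\<sim> a"] subfms[of "\<triangle> a"] subfms[of "\<box> a"] subfms[of "\<diamond> a"]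
    subfms[of "a \<^bold>\<and> b"] subfms[of "a \<^bold>\<or> b"] subfms[of "a \<^bold>\<rightarrow> b"] by auto

end

text \<open>Only the order of the values matters for the propositional connectives, so a state pairs a
  prime theory with a valuation of the finite fragment \<open>F\<close> that represents the order it induces.\<close>

locale state = fragment F + prime_theory T for F T +
  fixes e :: "fm \<Rightarrow> real"
  assumes e_Bot: "e \<^bold>0 = 0" and e_Top: "e \<^bold>1 = 1"
    and e_le: "a \<in> F \<Longrightarrow> b \<in> F \<Longrightarrow> e a \<le> e b \<longleftrightarrow> a \<^bold>\<rightarrow> b \<in> T"
begin

lemma e_eq_1: "a \<in> F \<Longrightarrow> e a = 1 \<longleftrightarrow> a \<in> T"
  using e_le[of "\<^bold>1" a] e_le[of a "\<^bold>1"] weaken[OF Top_mem, of a] const_mem by (auto simp: e_Top Top_le_iff)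

lemma e_eq_0: "a \<in> F \<Longrightarrow> e a = 0 \<longleftrightarrow> a \<^bold>\<rightarrow> \<^bold>0 \<in> T"
  using e_le[of "\<^bold>0" a] e_le[of a "\<^bold>0"] bot_le[of a] const_mem by (auto simp: e_Bot)

lemma e_bounds: "a \<in> F \<Longrightarrow> 0 \<le> e a \<and> e a \<le> 1"
  using e_le[of "\<^bold>0" a] e_le[of a "\<^bold>1"] bot_le[of a] weaken[OF Top_mem, of a] const_mem
  by (simp add: e_Bot e_Top)

lemma e_Neg: "\<^bold>\<sim> a \<in> F \<Longrightarrow> e (\<^bold>\<sim> a) = g_neg (e a)"
proof -
  assume F: "\<^bold>\<sim> a \<in> F"
  show ?thesis
  proof (cases "a \<^bold>\<rightarrow> \<^bold>0 \<in> T")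
    case True
    then have "\<^bold>\<sim> a \<in> T" by (rule mp[OF _ le_neg])
    then show ?thesis using True F closed(1)[OF F] by (simp add: g_neg_def e_eq_0 e_eq_1)
  next
    case False
    \<comment> \<open>\<open>\<sim> a\<close> is below \<open>a \<rightarrow> Bot\<close>, which
      collapses to \<open>Bot\<close> by \<open>imp_notin\<close>.\<close>
    then have "\<^bold>\<sim> a \<^bold>\<rightarrow> \<^bold>0 \<in> T" by (rule le_trans[OF neg_le imp_notin])
    then show ?thesis using False F closed(1)[OF F] by (simp add: g_neg_def e_eq_0)
  qed
qed

lemma e_Delta: "\<triangle> a \<in> F \<Longrightarrow> e (\<triangle> a) = g_delta (e a)"
proof -
  assume F: "\<triangle> a \<in> F"
  show ?thesis
  proof (cases "a \<in> T")
    case True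
    then show ?thesis
      using delta[OF True] F closed(2)[OF F] by (simp add: g_delta_def e_eq_1)
  next
    case False
    then have "\<triangle> a \<^bold>\<rightarrow> \<^bold>0 \<in> T" by (rule mp[OF delta_notin neg_le])
    then show ?thesis using False F closed(2)[OF F] by (simp add: g_delta_def e_eq_0 e_eq_1)
  qed
qed

lemma e_Conj: "a \<^bold>\<and> b \<in> F \<Longrightarrow> e (a \<^bold>\<and> b) = min (e a) (e b)"
proof -
  assume F: "a \<^bold>\<and> b \<in> F"
  note ab = conjunct1[OF closed(5)[OF F]] conjunct2[OF closed(5)[OF F]]
  have "e (a \<^bold>\<and> b) \<le> e a" "e (a \<^bold>\<and> b) \<le> e b"
    using e_le[OF F ab(1)] e_le[OF F ab(2)] le_conjE1 le_conjE2 by auto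
  moreover have "e a \<le> e (a \<^bold>\<and> b) \<or> e b \<le> e (a \<^bold>\<and> b)"
    using e_le[OF ab(1) F] e_le[OF ab(2) F] conj_le[OF le_refl] by simp
  ultimately show ?thesis by auto
qed

lemma e_Disj: "a \<^bold>\<or> b \<in> F \<Longrightarrow> e (a \<^bold>\<or> b) = max (e a) (e b)"
proof -
  assume F: "a \<^bold>\<or> b \<in> F"
  note ab = conjunct1[OF closed(6)[OF F]] conjunct2[OF closed(6)[OF F]]
  have "e a \<le> e (a \<^bold>\<or> b)" "e b \<le> e (a \<^bold>\<or> b)"
    using e_le[OF ab(1) F] e_le[OF ab(2) F] le_disjI1 le_disjI2 by auto
  moreover have "e (a \<^bold>\<or> b) \<le> e a \<or> e (a \<^bold>\<or> b) \<le> e b"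
    using e_le[OF F ab(1)] e_le[OF F ab(2)] le_disj[OF le_refl] by simp
  ultimately show ?thesis by auto
qed

lemma e_Imp: "a \<^bold>\<rightarrow> b \<in> F \<Longrightarrow> e (a \<^bold>\<rightarrow> b) = g_imp (e a) (e b)"
proof -
  assume F: "a \<^bold>\<rightarrow> b \<in> F"
  note ab = conjunct1[OF closed(7)[OF F]] conjunct2[OF closed(7)[OF F]]
  show ?thesis
  proof (cases "a \<^bold>\<rightarrow> b \<in> T")
    case True
    then show ?thesis using e_le[OF ab] e_eq_1[OF F] by (simp add: g_imp_def)
  next
    case False
    have "e (a \<^bold>\<rightarrow> b) = e b"
      using e_le[OF F ab(2)] e_le[OF ab(2) F] imp_notin[OF False] le_weaken by (simp add: antisym)
    then show ?thesis using e_le[OF ab] False by (simp add: g_imp_def)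
  qed
qed

definition accessible :: "(fm \<Rightarrow> real) \<Rightarrow> bool" where
  "accessible e' \<longleftrightarrow> (\<forall>a. (\<box> a \<in> F \<longrightarrow> e (\<box> a) \<le> e' a) \<and> (\<diamond> a \<in> F \<longrightarrow> e' a \<le> e (\<diamond> a)))"

text \<open>A successor theory becomes a successor state in which \<open>a\<close> moreover takes a value in \<open>[l, u]\<close>;
  \<open>-1\<close> and \<open>2\<close> stand for absent bounds.\<close>

lemma successor_state:
  assumes U: "successor U" and a: "a \<in> F" and lu: "l < u" "l < 2" "-1 < u"
    and u: "\<And>x. \<box> x \<in> F \<Longrightarrow> x \<^bold>\<rightarrow> a \<in> U \<Longrightarrow> e (\<box> x) < u"
    and l: "\<And>x. \<diamond> x \<in> F \<Longrightarrow> a \<^bold>\<rightarrow> x \<in> U \<Longrightarrow> l < e (\<diamond> x)"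
  shows "\<exists>e'. state F U e' \<and> accessible e' \<and> l \<le> e' a \<and> e' a \<le> u"
proof -
  interpret U: prime_theory U using U by (simp add: successor_def)
  define lo where "lo x = max (if \<box> x \<in> F then e (\<box> x) else - 1) (if x = a then l else - 1)" for x
  define up where "up x = min (if \<diamond> x \<in> F then e (\<diamond> x) else 2) (if x = a then u else 2)" for x
  \<comment> \<open>Every member of \<open>U\<close> has its diamond in \<open>T\<close>, and
    \<open>dia_imp\<close> turns the diamond of \<open>x \<rightarrow> y\<close> into an inequality
    between the two bounds.\<close>
  have weak: "e (\<box> x) \<le> e (\<diamond> y)" if "\<box> x \<in> F" "\<diamond> y \<in> F" "x \<^bold>\<rightarrow> y \<in> U" for x y
  proof -
    have "\<diamond> (x \<^bold>\<rightarrow> y) \<in> T" using U that(3) by (simp add: successor_def)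
    then have "\<box> x \<^bold>\<rightarrow> \<diamond> y \<in> T" by (rule mp[OF _ modal_ax[OF dia_imp]])
    then show ?thesis using e_le that by simp
  qed
  \<comment> \<open>If the bounds were equal or reversed, \<open>dia_box\<close> would put
    \<open>\<box> (y \<rightarrow> x)\<close> into \<open>T\<close> and hence
    \<open>y \<rightarrow> x\<close> into \<open>U\<close>.\<close>
  have strict: "e (\<box> x) < e (\<diamond> y)" if "\<box> x \<in> F" "\<diamond> y \<in> F" "y \<^bold>\<rightarrow> x \<notin> U" for x y
  proof (rule ccontr)
    assume "\<not> ?thesis"
    then have "\<diamond> y \<^bold>\<rightarrow> \<box> x \<in> T" using e_le[OF that(2,1)] by simp
    then have "\<box> (y \<^bold>\<rightarrow> x) \<in> T" by (rule mp[OF _ modal_ax[OF dia_box]])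
    then show False using U that(3) by (simp add: successor_def)
  qed
  \<comment> \<open>Two modal bounds are compared by \<open>weak\<close> and \<open>strict\<close>.
    All other comparisons are strict: modal bounds against \<open>l\<close> and \<open>u\<close> by
    the assumptions of these names, \<open>l\<close> and \<open>u\<close> against each other and
    against absent bounds by \<open>lu\<close>, modal against absent bounds by
    \<open>e_bounds\<close>.\<close>
  have mixed: "lo x \<le> up y \<and> (y \<^bold>\<rightarrow> x \<notin> U \<longrightarrow> lo x < up y)" if "x \<^bold>\<rightarrow> y \<in> U" for x y
  proof -
    have "\<box> x \<in> F \<Longrightarrow> e (\<box> x) < 2" "\<diamond> y \<in> F \<Longrightarrow> - 1 < e (\<diamond> y)"
      using e_bounds[of "\<box> x"] e_bounds[of "\<diamond> y"] by auto
    then show ?thesis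
      using weak[of x y] strict[of x y] u[of x] l[of y] lu that by (auto simp: lo_def up_def)
  qed
  have "\<exists>e'. \<forall>x\<in>F. lo x \<le> e' x \<and> e' x \<le> up x \<and> (\<forall>y\<in>F. e' x \<le> e' y \<longleftrightarrow> x \<^bold>\<rightarrow> y \<in> U)"
    using finite mixed U.le_total by (intro U.valuation_within_bounds) blast+
  then obtain e' where e': "\<And>x. x \<in> F \<Longrightarrow> lo x \<le> e' x \<and> e' x \<le> up x"
    and le: "\<And>x y. x \<in> F \<Longrightarrow> y \<in> F \<Longrightarrow> e' x \<le> e' y \<longleftrightarrow> x \<^bold>\<rightarrow> y \<in> U" by blast
  have "e (\<box> x) \<le> e' x" if "\<box> x \<in> F" for x
    using conjunct1[OF e'[OF closed(3)[OF that]]] that by (simp add: lo_def)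
  moreover have "e' x \<le> e (\<diamond> x)" if "\<diamond> x \<in> F" for x
    using conjunct2[OF e'[OF closed(4)[OF that]]] that by (simp add: up_def)
  ultimately have acc: "accessible e'" by (simp add: accessible_def)
  \<comment> \<open>The constants are squeezed: \<open>e' Top\<close> lies between
    \<open>e (\<box> Top) = 1\<close> and \<open>e (\<diamond> Top) \<le> 1\<close>, and
    \<open>e' Bot\<close> between \<open>e (\<box> Bot) \<ge> 0\<close> and
    \<open>e (\<diamond> Bot) = 0\<close>.\<close>
  have "\<box> \<^bold>1 \<in> T" "\<diamond> \<^bold>0 \<^bold>\<rightarrow> \<^bold>0 \<in> T"
    using delta_theory.Top_mem[OF delta_theory_HKbiG] provable[OF HKbiG.box_nec]
      mp[OF modal_ax[OF dia_bot] neg_le] by auto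
  then have "e (\<box> \<^bold>1) = 1" "e (\<diamond> \<^bold>0) = 0" using modal_consts e_eq_0 e_eq_1 by auto
  moreover have "0 \<le> e (\<box> \<^bold>0)" "e (\<diamond> \<^bold>1) \<le> 1" using modal_consts e_bounds by auto
  moreover have "e (\<box> \<^bold>1) \<le> e' \<^bold>1" "e (\<box> \<^bold>0) \<le> e' \<^bold>0" "e' \<^bold>1 \<le> e (\<diamond> \<^bold>1)" "e' \<^bold>0 \<le> e (\<diamond> \<^bold>0)"
    using acc modal_consts by (simp_all add: accessible_def)
  ultimately have "state F U e'" using le by unfold_locales auto
  moreover have "l \<le> e' a" "e' a \<le> u" using e'[OF a] by (auto simp: lo_def up_def)
  ultimately show ?thesis using acc by blast
qed

text \<open>\<open>Box_witness\<close> bounds every relevant \<open>e (\<box> x)\<close> by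
  \<open>e (\<box> a)\<close>; the slack \<epsilon> makes the inequality strict, as
  \<open>successor_state\<close> demands.\<close>

lemma Box_successor:
  assumes F: "\<box> a \<in> F" and ne: "e (\<box> a) \<noteq> 1" and pos: "0 < \<epsilon>"
  shows "\<exists>U e'. state F U e' \<and> accessible e' \<and> e' a \<le> e (\<box> a) + \<epsilon>"
proof -
  have "\<box> a \<notin> T" using F ne e_eq_1 by simp
  then obtain U where U: "successor U" "\<And>b. b \<^bold>\<rightarrow> a \<in> U \<Longrightarrow> \<box> b \<^bold>\<rightarrow> \<box> a \<in> T"
    using Box_witness by blast
  have "\<exists>e'. state F U e' \<and> accessible e' \<and> - 1 \<le> e' a \<and> e' a \<le> e (\<box> a) + \<epsilon>"
  proof (rule successor_state[OF U(1)])
    show "e (\<box> x) < e (\<box> a) + \<epsilon>" if "\<box> x \<in> F" "x \<^bold>\<rightarrow> a \<in> U" for x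
      using e_le[OF that(1) F] U(2)[OF that(2)] pos by simp
    show "- 1 < e (\<diamond> x)" if "\<diamond> x \<in> F" for x using e_bounds[OF that] by simp
  qed (use e_bounds[OF F] pos closed(3)[OF F] in auto)
  then show ?thesis by blast
qed

lemma Dia_successor:
  assumes F: "\<diamond> a \<in> F" and ne: "e (\<diamond> a) \<noteq> 0" and pos: "0 < \<epsilon>"
  shows "\<exists>U e'. state F U e' \<and> accessible e' \<and> e (\<diamond> a) - \<epsilon> \<le> e' a"
proof -
  have "\<diamond> a \<^bold>\<rightarrow> \<^bold>0 \<notin> T" using F ne e_eq_0 by simp
  then obtain U where U: "successor U" "\<And>b. a \<^bold>\<rightarrow> b \<in> U \<Longrightarrow> \<diamond> a \<^bold>\<rightarrow> \<diamond> b \<in> T"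
    using Dia_witness by blast
  have "\<exists>e'. state F U e' \<and> accessible e' \<and> e (\<diamond> a) - \<epsilon> \<le> e' a \<and> e' a \<le> 2"
  proof (rule successor_state[OF U(1)])
    show "e (\<diamond> a) - \<epsilon> < e (\<diamond> x)" if "\<diamond> x \<in> F" "a \<^bold>\<rightarrow> x \<in> U" for x
      using e_le[OF F that(1)] U(2)[OF that(2)] pos by simp
    show "e (\<box> x) < 2" if "\<box> x \<in> F" for x using e_bounds[OF that] by simp
  qed (use e_bounds[OF F] pos closed(4)[OF F] in auto)
  then show ?thesis by blast
qed

end

section \<open>The countable refuting model\<close>

lemma countable_closure:
  assumes "s0 \<in> K" and "countable I"
    and step: "\<And>s i. s \<in> K \<Longrightarrow> i \<in> I \<Longrightarrow> P i s \<Longrightarrow> \<exists>t\<in>K. Q i s t"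
  shows "\<exists>S\<subseteq>K. countable S \<and> s0 \<in> S \<and> (\<forall>s\<in>S. \<forall>i\<in>I. P i s \<longrightarrow> (\<exists>t\<in>S. Q i s t))"
proof -
  \<comment> \<open>One witness is chosen per demand; a state without the demand stays put, so
    \<open>nxt\<close> never leaves \<open>K\<close>.\<close>
  define nxt where "nxt i s = (if P i s then SOME t. t \<in> K \<and> Q i s t else s)" for i s
  have nxt_P: "nxt i s \<in> K \<and> Q i s (nxt i s)" if "s \<in> K" "i \<in> I" "P i s" for i s
    using someI_ex[of "\<lambda>t. t \<in> K \<and> Q i s t"] step[OF that] that(3) unfolding nxt_def by auto
  have nxt_K: "nxt i s \<in> K" if "s \<in> K" "i \<in> I" for i s
    using nxt_P[OF that] that(1) by (cases "P i s") (simp_all add: nxt_def)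
  \<comment> \<open>These are the states reached from \<open>s0\<close> by finite words of demands,
    and there are only countably many such words.\<close>
  define S where "S = (\<lambda>l. foldr nxt l s0) ` lists I"
  have "foldr nxt l s0 \<in> K" if "l \<in> lists I" for l
    using that by (induction l) (auto simp: assms(1) nxt_K)
  then have "S \<subseteq> K" by (auto simp: S_def)
  moreover have "countable S" using assms(2) by (simp add: S_def)
  moreover have "s0 \<in> S" unfolding S_def by (intro image_eqI[of _ _ "[]"]) auto
  moreover have "\<exists>t\<in>S. Q i s t" if "s \<in> S" "i \<in> I" "P i s" for s i
  proof -
    from that(1) obtain l where l: "l \<in> lists I" "s = foldr nxt l s0" by (auto simp: S_def)
    then have "nxt i s \<in> S" using that(2) unfolding S_def by (intro image_eqI[of _ _ "i # l"]) auto
    then show ?thesis using nxt_P that \<open>S \<subseteq> K\<close> by blast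
  qed
  ultimately show ?thesis by (intro HOL.exI[of _ S]) simp
qed

text \<open>No witness is demanded for the value 1, which admits the empty set with
  \<open>inf01 {} = 1\<close>. Below 1, countably many tolerances suffice by the Archimedean
  property. The value 0 has this place for suprema.\<close>

lemma inf01_eqI:
  assumes "A \<subseteq> {0..1}" and "\<And>x. x \<in> A \<Longrightarrow> c \<le> x" and "c \<le> 1"
    and "\<And>n. c \<noteq> 1 \<Longrightarrow> \<exists>x\<in>A. x \<le> c + inverse (real (Suc n))"
  shows "inf01 A = c"
proof (rule antisym)
  show "c \<le> inf01 A" using assms(2,3) by (rule inf01_greatest)
  show "inf01 A \<le> c"
  proof (cases "c = 1")
    case False
    show ?thesis
    proof (rule ccontr)
      assume "\<not> ?thesis"
      then obtain n where n: "inverse (real (Suc n)) < inf01 A - c"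
        using reals_Archimedean[of "inf01 A - c"] by auto
      obtain x where x: "x \<in> A" "x \<le> c + inverse (real (Suc n))" using assms(4)[OF False] by blast
      from inf01_lower[OF x(1) assms(1)] n x(2) show False by linarith
    qed
  qed (use inf01_bounds[OF assms(1)] in simp)
qed

lemma sup01_eqI:
  assumes "A \<subseteq> {0..1}" and "\<And>x. x \<in> A \<Longrightarrow> x \<le> c" and "0 \<le> c"
    and "\<And>n. c \<noteq> 0 \<Longrightarrow> \<exists>x\<in>A. c - inverse (real (Suc n)) \<le> x"
  shows "sup01 A = c"
proof (rule antisym)
  show "sup01 A \<le> c" using assms(2,3) by (rule sup01_least)
  show "c \<le> sup01 A"
  proof (cases "c = 0")
    case False
    show ?thesis
    proof (rule ccontr)
      assume "\<not> ?thesis"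
      then obtain n where n: "inverse (real (Suc n)) < c - sup01 A"
        using reals_Archimedean[of "c - sup01 A"] by auto
      obtain x where x: "x \<in> A" "c - inverse (real (Suc n)) \<le> x" using assms(4)[OF False] by blast
      from sup01_upper[OF x(1) assms(1)] n x(2) show False by linarith
    qed
  qed (use sup01_bounds[OF assms(1)] in simp)
qed

lemma fragment_exists: "\<exists>F. fragment F \<and> \<phi> \<in> F"
proof -
  let ?F = "\<Union>(subfms ` {\<phi>, \<box> \<^bold>0, \<box> \<^bold>1, \<diamond> \<^bold>0, \<diamond> \<^bold>1})"
  have "fragment ?F"
  proof
    show "subfms a \<subseteq> ?F" if "a \<in> ?F" for a using that subfms_trans by fastforce
  qed (auto simp: finite_subfms)
  then show ?thesis by (intro exI[of _ ?F]) auto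
qed

lemma (in prime_theory) state_exists:
  assumes "fragment F"
  shows "\<exists>e. state F T e"
proof -
  interpret fragment F by fact
  \<comment> \<open>Only the two constants are pinned, consistently because \<open>Top\<close> is
    not below \<open>Bot\<close>; the order then forces all other values into
    \<open>[0,1]\<close>.\<close>
  let ?lo = "\<lambda>x. if x = \<^bold>1 then 1 else if x = \<^bold>0 then 0 else - 1 :: real"
  let ?up = "\<lambda>x. if x = \<^bold>0 then 0 else if x = \<^bold>1 then 1 else 2 :: real"
  have ne: "\<^bold>1 \<noteq> \<^bold>0" and "\<^bold>1 \<^bold>\<rightarrow> \<^bold>0 \<notin> T" and "\<And>x. x \<^bold>\<rightarrow> \<^bold>1 \<in> T" "\<And>x. \<^bold>0 \<^bold>\<rightarrow> x \<in> T"
    using Top_le_iff Bot_notin weaken[OF Top_mem] bot_le by (auto simp: Bot_def Top_def)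
  then have "\<exists>e. \<forall>x\<in>F. ?lo x \<le> e x \<and> e x \<le> ?up x \<and> (\<forall>y\<in>F. e x \<le> e y \<longleftrightarrow> x \<^bold>\<rightarrow> y \<in> T)"
    by (intro valuation_within_bounds[OF finite]) (auto split: if_splits)
  then obtain e where e: "\<And>x. x \<in> F \<Longrightarrow> ?lo x \<le> e x \<and> e x \<le> ?up x"
    and le: "\<And>x y. x \<in> F \<Longrightarrow> y \<in> F \<Longrightarrow> e x \<le> e y \<longleftrightarrow> x \<^bold>\<rightarrow> y \<in> T" by blast
  have "state F T e"
    using le e[OF const_mem(1)] e[OF const_mem(2)] ne by unfold_locales auto
  then show ?thesis by blast
qed

lemma refuting_model_exists:
  assumes inf: "infinite (UNIV :: 'w set)" and "\<not> \<turnstile> \<phi>"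
  shows "\<exists>(W :: 'w set) R v. crisp_model W R v \<and> (\<exists>w\<in>W. eval R v \<phi> w \<noteq> 1)"
proof -
  interpret H: delta_theory "{\<phi>. \<turnstile> \<phi>}" by (rule delta_theory_HKbiG)
  obtain F where F: "fragment F" and \<phi>: "\<phi> \<in> F" using fragment_exists by blast
  interpret fragment F by fact
  have "\<exists>T. prime_theory T \<and> {\<phi>. \<turnstile> \<phi>} \<subseteq> T \<and> T \<inter> {\<phi>} = {}"
    using H.disj_leI[OF H.le_refl H.le_refl] assms(2)
    by (intro prime_theory_exists delta_theory_HKbiG) auto
  then obtain T0 where T0: "prime_theory T0" "\<phi> \<notin> T0" by blast
  obtain e0 where e0: "state F T0 e0" using prime_theory.state_exists[OF T0(1) F] by blast
  interpret s0: state F T0 e0 by (rule e0)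
  define acc where "acc s t \<longleftrightarrow> state.accessible F (snd s) (snd t)"
    for s t :: "fm set \<times> (fm \<Rightarrow> real)"
  let ?K = "{s. state F (fst s) (snd s)}"
  \<comment> \<open>A demand \<open>(a, n)\<close> asks for a successor that approximates the modal
    formula \<open>a\<close> within \<open>1 / (n + 1)\<close>. It is void for boxes of value 1 and
    diamonds of value 0, where there may be no successor at all.\<close>
  let ?P = "\<lambda>(a, n :: nat) s. (\<exists>b. a = \<box> b \<and> snd s a \<noteq> 1) \<or> (\<exists>b. a = \<diamond> b \<and> snd s a \<noteq> (0 :: real))"
  let ?Q = "\<lambda>(a, n :: nat) s t. acc s t \<and>
    (\<forall>b. a = \<box> b \<longrightarrow> snd t b \<le> snd s a + inverse (real (Suc n))) \<and>
    (\<forall>b. a = \<diamond> b \<longrightarrow> snd s a - inverse (real (Suc n)) \<le> snd t b)"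
  have "\<exists>S\<subseteq>?K. countable S \<and> (T0, e0) \<in> S \<and> (\<forall>s\<in>S. \<forall>i\<in>F \<times> UNIV. ?P i s \<longrightarrow> (\<exists>t\<in>S. ?Q i s t))"
  proof (rule countable_closure)
    show "(T0, e0) \<in> ?K" using e0 by simp
    show "countable (F \<times> (UNIV :: nat set))" using finite by (simp add: countable_finite)
    fix s :: "fm set \<times> (fm \<Rightarrow> real)" and i :: "fm \<times> nat"
    assume s: "s \<in> ?K" and i: "i \<in> F \<times> UNIV" and P: "?P i s"
    obtain a n where [simp]: "i = (a, n)" by (cases i)
    interpret s: state F "fst s" "snd s" using s by simp
    have a: "a \<in> F" using i by simp
    have pos: "0 < inverse (real (Suc n))" by simp
    have "(\<exists>b. a = \<box> b \<and> snd s a \<noteq> 1) \<or> (\<exists>b. a = \<diamond> b \<and> snd s a \<noteq> 0)" using P by simp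
    then show "\<exists>t\<in>?K. ?Q i s t"
    proof (elim HOL.disjE HOL.exE HOL.conjE)
      fix b assume b: "a = \<box> b" "snd s a \<noteq> 1"
      from s.Box_successor[OF _ _ pos, of b] a b obtain U e'
        where "state F U e'" "s.accessible e'" "e' b \<le> snd s (\<box> b) + inverse (real (Suc n))" by auto
      then show ?thesis using b by (intro bexI[of _ "(U, e')"]) (simp_all add: acc_def)
    next
      fix b assume b: "a = \<diamond> b" "snd s a \<noteq> 0"
      from s.Dia_successor[OF _ _ pos, of b] a b obtain U e'
        where "state F U e'" "s.accessible e'" "snd s (\<diamond> b) - inverse (real (Suc n)) \<le> e' b" by auto
      then show ?thesis using b by (intro bexI[of _ "(U, e')"]) (simp_all add: acc_def)
    qed
  qed
  then obtain S where SK: "S \<subseteq> ?K" and S: "countable S" "(T0, e0) \<in> S"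
    and wit: "\<forall>s\<in>S. \<forall>i\<in>F \<times> UNIV. ?P i s \<longrightarrow> (\<exists>t\<in>S. ?Q i s t)"
    by (elim HOL.exE HOL.conjE) (rule that)
  have wit_Box: "\<exists>t\<in>S. acc s t \<and> snd t a \<le> snd s (\<box> a) + inverse (real (Suc n))"
    if "s \<in> S" "\<box> a \<in> F" "snd s (\<box> a) \<noteq> 1" for s a n
    using bspec[OF bspec[OF wit that(1)], of "(\<box> a, n)"] that(2,3) by simp
  have wit_Dia: "\<exists>t\<in>S. acc s t \<and> snd s (\<diamond> a) - inverse (real (Suc n)) \<le> snd t a"
    if "s \<in> S" "\<diamond> a \<in> F" "snd s (\<diamond> a) \<noteq> 0" for s a n
    using bspec[OF bspec[OF wit that(1)], of "(\<diamond> a, n)"] that(2,3) by simp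
  have st: "state F (fst s) (snd s)" if "s \<in> S" for s using SK that by auto
  \<comment> \<open>Countability allows the states to be copied injectively into the infinite
    type.\<close>
  obtain g :: "nat \<Rightarrow> 'w" where g: "inj g" using infinite_countable_subset[OF inf] by blast
  define j where "j = g \<circ> to_nat_on S"
  have j: "inj_on j S" unfolding j_def
    using S(1) g by (intro comp_inj_on inj_on_to_nat_on) (auto intro: inj_on_subset)
  define W where "W = j ` S"
  define R where "R = {(j s, j t) |s t. s \<in> S \<and> t \<in> S \<and> acc s t}"
  have R_iff: "(j s, w) \<in> R \<longleftrightarrow> (\<exists>t. w = j t \<and> t \<in> S \<and> acc s t)" if "s \<in> S" for s w
  proof -
    have "(j s, w) \<in> R \<longleftrightarrow> (\<exists>s' t. j s = j s' \<and> w = j t \<and> s' \<in> S \<and> t \<in> S \<and> acc s' t)"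
      unfolding R_def by blast
    then show ?thesis using that inj_onD[OF j] by metis
  qed
  \<comment> \<open>\<open>e_bounds\<close> speaks only about \<open>F\<close>, so the default 0
    keeps the other variables within \<open>[0,1]\<close>.\<close>
  define v where "v p w = (if Var p \<in> F then snd (inv_into S j w) (Var p) else 0)" for p w
  have "crisp_model W R v"
    unfolding crisp_model_def
  proof (intro HOL.conjI allI ballI)
    show "W \<noteq> {}" using S(2) by (auto simp: W_def)
    show "R \<subseteq> W \<times> W" by (auto simp: R_def W_def)
    fix p w assume "w \<in> W"
    then have "0 \<le> v p w \<and> v p w \<le> 1"
      using j state.e_bounds[OF st] by (auto simp: v_def W_def)
    then show "0 \<le> v p w" "v p w \<le> 1" by auto
  qed
  \<comment> \<open>This is the truth lemma. In the modal cases accessibility gives one inequality,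
    and the witnesses collected in \<open>S\<close> give the approximation.\<close>
  moreover have ev: "eval R v a (j s) = snd s a" if "a \<in> F" "s \<in> S" for a s
    using that
  proof (induction a arbitrary: s)
    case (Var p)
    then show ?case using j by (simp add: v_def)
  next
    case (Neg a)
    then show ?case using state.e_Neg[OF st] closed(1)[OF Neg.prems(1)] by simp
  next
    case (Delta a)
    then show ?case using state.e_Delta[OF st] closed(2)[OF Delta.prems(1)] by simp
  next
    case (Conj a b)
    then show ?case using state.e_Conj[OF st] closed(5)[OF Conj.prems(1)] by simp
  next
    case (Disj a b)
    then show ?case using state.e_Disj[OF st] closed(6)[OF Disj.prems(1)] by simp
  next
    case (Imp a b)
    then show ?case using state.e_Imp[OF st] closed(7)[OF Imp.prems(1)] by simp
  next
    case (Box a)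
    interpret s: state F "fst s" "snd s" by (rule st[OF Box.prems(2)])
    have aF: "a \<in> F" using closed(3) Box.prems(1) .
    have A: "{eval R v a w' | w'. (j s, w') \<in> R} = {snd t a |t. t \<in> S \<and> acc s t}"
      using R_iff[OF Box.prems(2)] Box.IH[OF aF] by (intro Collect_cong) metis
    have "inf01 {snd t a |t. t \<in> S \<and> acc s t} = snd s (\<box> a)"
    proof (rule inf01_eqI)
      show "{snd t a |t. t \<in> S \<and> acc s t} \<subseteq> {0..1}" using state.e_bounds[OF st aF] by auto
      show "snd s (\<box> a) \<le> x" if "x \<in> {snd t a |t. t \<in> S \<and> acc s t}" for x
        using that Box.prems(1) by (auto simp: acc_def s.accessible_def)
      show "snd s (\<box> a) \<le> 1" using s.e_bounds[OF Box.prems(1)] by simp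
      show "\<exists>x\<in>{snd t a |t. t \<in> S \<and> acc s t}. x \<le> snd s (\<box> a) + inverse (real (Suc n))"
        if "snd s (\<box> a) \<noteq> 1" for n
        using wit_Box[OF Box.prems(2,1) that, of n] by blast
    qed
    then show ?case by (simp add: A)
  next
    case (Dia a)
    interpret s: state F "fst s" "snd s" by (rule st[OF Dia.prems(2)])
    have aF: "a \<in> F" using closed(4) Dia.prems(1) .
    have A: "{eval R v a w' | w'. (j s, w') \<in> R} = {snd t a |t. t \<in> S \<and> acc s t}"
      using R_iff[OF Dia.prems(2)] Dia.IH[OF aF] by (intro Collect_cong) metis
    have "sup01 {snd t a |t. t \<in> S \<and> acc s t} = snd s (\<diamond> a)"
    proof (rule sup01_eqI)
      show "{snd t a |t. t \<in> S \<and> acc s t} \<subseteq> {0..1}" using state.e_bounds[OF st aF] by auto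
      show "x \<le> snd s (\<diamond> a)" if "x \<in> {snd t a |t. t \<in> S \<and> acc s t}" for x
        using that Dia.prems(1) by (auto simp: acc_def s.accessible_def)
      show "0 \<le> snd s (\<diamond> a)" using s.e_bounds[OF Dia.prems(1)] by simp
      show "\<exists>x\<in>{snd t a |t. t \<in> S \<and> acc s t}. snd s (\<diamond> a) - inverse (real (Suc n)) \<le> x"
        if "snd s (\<diamond> a) \<noteq> 0" for n
        using wit_Dia[OF Dia.prems(2,1) that, of n] by blast
    qed
    then show ?case by (simp add: A)
  qed
  moreover have "eval R v \<phi> (j (T0, e0)) \<noteq> 1"
    using ev[OF \<phi> S(2)] s0.e_eq_1[OF \<phi>] T0(2) by simp
  ultimately show ?thesis using S(2) unfolding W_def by blast
qed

theorem theorem1: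
  fixes \<phi> :: fm
  assumes "infinite (UNIV :: 'w set)"
  shows "KbiG_valid TYPE('w) \<phi> \<longleftrightarrow> \<turnstile> \<phi>"
proof
  show "\<turnstile> \<phi>" if "KbiG_valid TYPE('w) \<phi>"
    using refuting_model_exists[OF assms, of \<phi>] that unfolding KbiG_valid_def by blast
  show "KbiG_valid TYPE('w) \<phi>" if "\<turnstile> \<phi>"
    unfolding KbiG_valid_def by (intro allI impI ballI HKbiG_sound[OF _ that])
qed

end
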